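(* In the setting of the $p$-order autoregressive process with first-order autoregressive noise described in the context, the least squares estimator satisfies $$\lim_{n\to\infty}\widehat{\theta}_n=\theta^{*}\quad\text{almost surely},$$ where $\theta^{*}=\alpha\,(I_p-\theta_p\rho J_p)\,\beta$.
   Context: Let $p\ge 1$ be an integer, $\theta=(\theta_1,\dots,\theta_p)'\in\mathbb{R}^p$ a nonzero vector with $\|\theta\|_1=\sum_i|\theta_i|<1$ and $\rho\in\mathbb{R}$ with $|\rho|<1$. A prime denotes transposition. The process is given, for all $n\ge1$, by $$X_n=\theta_1X_{n-1}+\cdots+\theta_pX_{n-p}+\varepsilon_n,\qquad \varepsilon_n=\rho\,\varepsilon_{n-1}+V_n,$$ with square-integrable initial value $X_0=\varepsilon_0$ and $X_{-1}=X_{-2}=\cdots=X_{-p}=0$, where $(V_n)$ is a sequence of square-integrable, independent and identically distributed random variables with zero mean and variance $\sigma^2>0$. Let $\Phi_n^p=(X_n,X_{n-1},\dots,X_{n-p+1})'$ and $S_n=\sum_{k=0}^n\Phi_k^p(\Phi_k^p)'+S$, where $S$ is a fixed symmetric positive definite $p\times p$ matrix. The least squares estimator of $\theta$ is, for $n\ge1$, $$\widehat{\theta}_n=(S_{n-1})^{-1}\sum_{k=1}^n\Phi_{k-1}^pX_k.$$ $I_p$ is the identity matrix of order $p$ and $J_p$ the exchange matrix of order $p$ (ones on the antidiagonal, zeros elsewhere). Moreover $$\alpha=\frac{1}{(1-\theta_p\rho)(1+\theta_p\rho)},\qquad \beta=(\theta_1+\rho,\ \theta_2-\theta_1\rho,\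 \dots,\ \theta_p-\theta_{p-1}\rho)'.$$ *)

theory Defs
  imports "HOL-Probability.Probability" "Jordan_Normal_Form.Gauss_Jordan_Elimination"
begin

text \<open>
  Vectors and matrices are those of Jordan_Normal_Form, since their indices are linearly ordered
  and the dimension \<open>p\<close> is a natural number. Indices start at 0, so the mathematical
  \<open>\<theta>\<^sub>i\<close> (for \<open>1 \<le> i \<le> p\<close>) is \<open>\<theta> $ (i - 1)\<close>; in particular \<open>\<theta>\<^sub>p\<close> is \<open>\<theta> $ (p - 1)\<close>.
\<close>

unbundle no vec_syntax
unbundle no inner_syntax
hide_const (open) Finite_Cartesian_Product.vec Finite_Cartesian_Product.mat

definition sym_pos_def_mat :: "nat \<Rightarrow> real mat \<Rightarrow> bool" where
  "sym_pos_def_mat p A \<longleftrightarrow>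
     A \<in> carrier_mat p p \<and> transpose_mat A = A \<and>
     (\<forall>v \<in> carrier_vec p. v \<noteq> 0\<^sub>v p \<longrightarrow> v \<bullet> (A *\<^sub>v v) > 0)"

definition exchange_mat :: "nat \<Rightarrow> real mat" where
  "exchange_mat p = mat p p (\<lambda>(i, j). if i + j = p - 1 then 1 else 0)"

text \<open>
  A trajectory is a function \<open>x\<close> on the integers, of which only the values at
  \<open>-p, -p + 1, \<dots>\<close> matter.
\<close>

definition regressor :: "nat \<Rightarrow> (int \<Rightarrow> real) \<Rightarrow> nat \<Rightarrow> real vec" where
  "regressor p x n = vec p (\<lambda>i. x (int n - int i))"

text \<open>The entry \<open>(i, j)\<close> of \<open>\<Phi> \<Phi>'\<close> is \<open>\<Phi> $ i * \<Phi> $ j\<close>.\<close>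

definition design_mat :: "nat \<Rightarrow> real mat \<Rightarrow> (int \<Rightarrow> real) \<Rightarrow> nat \<Rightarrow> real mat" where
  "design_mat p S x n =
     mat p p (\<lambda>(i, j). \<Sum>k=0..n. regressor p x k $ i * regressor p x k $ j) + S"

text \<open>
  Only meaningful for \<open>n \<ge> 1\<close>. The matrix \<open>design_mat p S x (n - 1)\<close> is invertible when \<open>S\<close> is
  positive definite, so that \<open>mat_inverse\<close> then does not return \<open>None\<close>.
\<close>

definition ls_estimator :: "nat \<Rightarrow> real mat \<Rightarrow> (int \<Rightarrow> real) \<Rightarrow> nat \<Rightarrow> real vec" where
  "ls_estimator p S x n =
     the (mat_inverse (design_mat p S x (n - 1))) *\<^sub>v
     vec p (\<lambda>i. \<Sum>k=1..n. regressor p x (k - 1) $ i * x (int k))"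

definition alpha_const :: "nat \<Rightarrow> real vec \<Rightarrow> real \<Rightarrow> real" where
  "alpha_const p \<theta> \<rho> = 1 / ((1 - \<theta> $ (p - 1) * \<rho>) * (1 + \<theta> $ (p - 1) * \<rho>))"

definition beta_vec :: "nat \<Rightarrow> real vec \<Rightarrow> real \<Rightarrow> real vec" where
  "beta_vec p \<theta> \<rho> =
     vec p (\<lambda>i. if i = 0 then \<theta> $ 0 + \<rho> else \<theta> $ i - \<theta> $ (i - 1) * \<rho>)"

definition theta_star :: "nat \<Rightarrow> real vec \<Rightarrow> real \<Rightarrow> real vec" where
  "theta_star p \<theta> \<rho> =
     alpha_const p \<theta> \<rho> \<cdot>\<^sub>v
       ((1\<^sub>m p - (\<theta> $ (p - 1) * \<rho>) \<cdot>\<^sub>m exchange_mat p) *\<^sub>v beta_vec p \<theta> \<rho>)"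

end

theory Submission
  imports Defs
    "Jordan_Normal_Form.Determinant"
    "HOL-Library.Landau_Symbols"
    "HOL-Library.Discrete_Functions"
    "HOL-Computational_Algebra.Formal_Power_Series"
begin

text \<open>
  The noise \<open>\<epsilon>\<close> satisfies a first-order recursion, so eliminating it shows that \<open>X\<close> is an
  autoregression of order \<open>p + 1\<close> driven by the white noise \<open>V\<close>:
  \<open>X\<^sub>n\<^sub>+\<^sub>1 = \<beta>' \<Phi>\<^sub>n - c X\<^sub>n\<^sub>-\<^sub>p + V\<^sub>n\<^sub>+\<^sub>1\<close> with \<open>c = \<theta>\<^sub>p \<rho>\<close>. Multiply by \<open>\<Phi>\<^sub>n\<close> and sum. Up to boundary terms
  the Gram matrix of the regressors is a symmetric Toeplitz matrix, hence it commutes with the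
  exchange matrix \<open>J\<close>, and the sum of the \<open>\<Phi>\<^sub>n X\<^sub>n\<^sub>-\<^sub>p\<close> is \<open>J\<close> applied to the sum of the
  \<open>\<Phi>\<^sub>n X\<^sub>n\<^sub>+\<^sub>1\<close>. Calling the latter sum \<open>A\<^sub>n\<close>, this reads \<open>(I + c J) A\<^sub>n = S\<^sub>n \<beta> + o(n)\<close>. As \<open>\<theta>\<^sup>*\<close> is the
  solution of \<open>(I + c J) \<theta>\<^sup>* = \<beta>\<close>, it follows that \<open>A\<^sub>n = S\<^sub>n \<theta>\<^sup>* + o(n)\<close>
  (lemma \<open>normal_equation_residual_smallo\<close>). The theorem follows as soon as the smallest eigenvalue of
  \<open>S\<^sub>n\<close> grows linearly (lemmas \<open>persistent_excitation\<close> and \<open>ls_estimator_tendsto\<close>).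

  What the argument takes from probability is that
  \<open>V\<^sub>n\<^sup>2 = o(n)\<close>, which controls the boundary terms, that the energy \<open>\<Sum>V\<^sub>k\<^sup>2\<close> is eventually at least a
  constant times \<open>n\<close>, and that sums of the present noise times a bounded linear function of the past
  noise are \<open>o(n)\<close> almost surely (lemmas \<open>AE_noise_square_smallo\<close>, \<open>AE_noise_energy_lower_bound\<close> and
  \<open>AE_predictable_sum_smallo\<close>). The last two rest on a strong law for orthogonal sequences with
  bounded second moments.

  To reach the past of the noise, \<open>X\<close> is written as a causal filter of \<open>V\<close>, with the initial value as a
  noise at time 0. Its impulse response \<open>\<psi>\<close> is summable because \<open>\<parallel>\<theta>\<parallel>\<^sub>1 < 1\<close> and \<open>\<bar>\<rho>\<bar> < 1\<close>; then the
  correlation of \<open>X\<close> at lag \<open>h\<close> with \<open>V\<close> is \<open>\<psi> h\<close> times the energy, up to \<open>o(n)\<close>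
  (lemma \<open>corr_causal_filter\<close>). This yields the orthogonality of \<open>V\<^sub>n\<^sub>+\<^sub>1\<close> to the regressor, and also the
  eigenvalue bound, since \<open>\<psi> 0 = 1\<close>.
\<close>

section \<open>A strong law for orthogonal sequences\<close>

lemma abs_mult_le_sum_squares: "\<bar>a * b\<bar> \<le> a\<^sup>2 + b\<^sup>2" for a b :: real
proof -
  have "2 * \<bar>a\<bar> * \<bar>b\<bar> \<le> a\<^sup>2 + b\<^sup>2"
    using sum_squares_bound[of "\<bar>a\<bar>" "\<bar>b\<bar>"] by simp
  moreover have "0 \<le> \<bar>a\<bar> * \<bar>b\<bar>"
    by simp
  ultimately show ?thesis
    unfolding abs_mult by linarith
qed

lemma integrable_mult_if_squares:
  fixes f g :: "'a \<Rightarrow> real"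
  assumes "f \<in> borel_measurable M" "g \<in> borel_measurable M"
    and "integrable M (\<lambda>x. (f x)\<^sup>2)" "integrable M (\<lambda>x. (g x)\<^sup>2)"
  shows "integrable M (\<lambda>x. f x * g x)"
proof (rule Bochner_Integration.integrable_bound)
  show "integrable M (\<lambda>x. (f x)\<^sup>2 + (g x)\<^sup>2)"
    using assms by auto
  show "AE x in M. norm (f x * g x) \<le> norm ((f x)\<^sup>2 + (g x)\<^sup>2)"
    using abs_mult_le_sum_squares by (intro AE_I2) simp
qed (use assms in auto)

lemma
  fixes W :: "'i \<Rightarrow> 'a \<Rightarrow> real"
  assumes "finite I"
    and meas: "\<And>i. i \<in> I \<Longrightarrow> W i \<in> borel_measurable M"
    and sq: "\<And>i. i \<in> I \<Longrightarrow> integrable M (\<lambda>x. (W i x)\<^sup>2)"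
    and orth: "\<And>i j. i \<in> I \<Longrightarrow> j \<in> I \<Longrightarrow> i \<noteq> j \<Longrightarrow> (\<integral>x. W i x * W j x \<partial>M) = 0"
  shows integrable_square_sum: "integrable M (\<lambda>x. (\<Sum>i\<in>I. W i x)\<^sup>2)"
    and integral_square_sum_orthogonal:
      "(\<integral>x. (\<Sum>i\<in>I. W i x)\<^sup>2 \<partial>M) = (\<Sum>i\<in>I. \<integral>x. (W i x)\<^sup>2 \<partial>M)"
proof -
  have int: "integrable M (\<lambda>x. W i x * W j x)" if "i \<in> I" "j \<in> I" for i j
    using that meas sq by (intro integrable_mult_if_squares) auto
  have expand: "(\<lambda>x. (\<Sum>i\<in>I. W i x)\<^sup>2) = (\<lambda>x. \<Sum>i\<in>I. \<Sum>j\<in>I. W i x * W j x)"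
    by (simp add: power2_eq_square sum_product)
  show "integrable M (\<lambda>x. (\<Sum>i\<in>I. W i x)\<^sup>2)"
    unfolding expand by (intro Bochner_Integration.integrable_sum int)
  have "(\<integral>x. (\<Sum>i\<in>I. W i x)\<^sup>2 \<partial>M) = (\<Sum>i\<in>I. \<Sum>j\<in>I. \<integral>x. W i x * W j x \<partial>M)"
    unfolding expand by (subst Bochner_Integration.integral_sum)
      (auto intro!: sum.cong Bochner_Integration.integrable_sum int Bochner_Integration.integral_sum)
  also have "\<dots> = (\<Sum>i\<in>I. \<Sum>j\<in>I. if i = j then \<integral>x. (W i x)\<^sup>2 \<partial>M else 0)"
    by (intro sum.cong) (auto simp: orth power2_eq_square)
  also have "\<dots> = (\<Sum>i\<in>I. \<integral>x. (W i x)\<^sup>2 \<partial>M)"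
    using \<open>finite I\<close> by simp
  finally show "(\<integral>x. (\<Sum>i\<in>I. W i x)\<^sup>2 \<partial>M) = (\<Sum>i\<in>I. \<integral>x. (W i x)\<^sup>2 \<partial>M)" .
qed

lemma AE_tendsto_zero_if_summable_integrals:
  fixes f :: "nat \<Rightarrow> 'a \<Rightarrow> real"
  assumes nonneg: "\<And>n x. 0 \<le> f n x"
    and int: "\<And>n. integrable M (f n)"
    and summ: "summable (\<lambda>n. \<integral>x. f n x \<partial>M)"
  shows "AE x in M. (\<lambda>n. f n x) \<longlonglongrightarrow> 0"
proof -
  have meas [measurable]: "f n \<in> borel_measurable M" for n
    using int by auto
  have "(\<integral>\<^sup>+ x. (\<Sum>n. ennreal (f n x)) \<partial>M) = (\<Sum>n. \<integral>\<^sup>+ x. ennreal (f n x) \<partial>M)"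
    by (rule nn_integral_suminf) simp
  also have "\<dots> = (\<Sum>n. ennreal (\<integral>x. f n x \<partial>M))"
    using int nonneg by (simp add: nn_integral_eq_integral)
  also have "\<dots> \<noteq> \<infinity>"
    using summ nonneg by (simp add: suminf_ennreal2 integral_nonneg)
  finally have "AE x in M. (\<Sum>n. ennreal (f n x)) \<noteq> \<infinity>"
    by (intro nn_integral_PInf_AE) auto
  then show ?thesis
  proof eventually_elim
    case (elim x)
    then have "summable (\<lambda>n. f n x)"
      using nonneg by (intro summable_suminf_not_top) auto
    then show ?case
      by (rule summable_LIMSEQ_zero)
  qed
qed

lemma smallo_real_iff: "f \<in> o(real) \<longleftrightarrow> (\<lambda>n. f n / real n) \<longlonglongrightarrow> 0"
  for f :: "nat \<Rightarrow> real"
proof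
  show "f \<in> o(real) \<Longrightarrow> (\<lambda>n. f n / real n) \<longlonglongrightarrow> 0"
    by (rule smalloD_tendsto)
  show "(\<lambda>n. f n / real n) \<longlonglongrightarrow> 0 \<Longrightarrow> f \<in> o(real)"
    by (rule smalloI_tendsto) (auto intro!: eventually_sequentiallyI[of 1])
qed

text \<open>
  Second moments of sums of \<open>m\<close> orthogonal terms grow like \<open>m\<close>, so the averages are summable in
  mean square along the squares \<open>n = j\<^sup>2\<close>, but not along all \<open>n\<close>. Between \<open>j\<^sup>2\<close> and \<open>(j + 1)\<^sup>2\<close> there
  are about \<open>2 j\<close> indices, with increments of at most about \<open>2 j\<close> terms each. The sum of all these
  squared increments therefore has mean of order \<open>j\<^sup>2\<close>, which is again summable against the
  normalization \<open>j\<^sup>4\<close>.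
\<close>

lemma AE_sum_orthogonal_smallo:
  fixes W :: "nat \<Rightarrow> 'a \<Rightarrow> real"
  assumes meas: "\<And>k. k \<ge> 1 \<Longrightarrow> W k \<in> borel_measurable M"
    and sq: "\<And>k. k \<ge> 1 \<Longrightarrow> integrable M (\<lambda>x. (W k x)\<^sup>2)"
    and orth: "\<And>k l. 1 \<le> l \<Longrightarrow> l < k \<Longrightarrow> (\<integral>x. W k x * W l x \<partial>M) = 0"
    and bound: "\<And>k. k \<ge> 1 \<Longrightarrow> (\<integral>x. (W k x)\<^sup>2 \<partial>M) \<le> B"
  shows "AE x in M. (\<lambda>n. \<Sum>k=1..n. W k x) \<in> o(real)"
proof -
  have orth': "(\<integral>x. W k x * W l x \<partial>M) = 0" if "1 \<le> l" "1 \<le> k" "k \<noteq> l" for k l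
    using orth[of l k] orth[of k l] that by (cases k l rule: linorder_cases) (auto simp: mult.commute)
  define S where "S m n x = (\<Sum>k\<in>{m<..n}. W k x)" for m n x
  have S_int: "integrable M (\<lambda>x. (S m n x)\<^sup>2)" for m n
    unfolding S_def using orth' meas sq by (intro integrable_square_sum) auto
  have S_bound: "(\<integral>x. (S m n x)\<^sup>2 \<partial>M) \<le> real (n - m) * B" for m n
  proof -
    have "(\<integral>x. (S m n x)\<^sup>2 \<partial>M) = (\<Sum>k\<in>{m<..n}. \<integral>x. (W k x)\<^sup>2 \<partial>M)"
      unfolding S_def using orth' meas sq by (intro integral_square_sum_orthogonal) auto
    also have "\<dots> \<le> (\<Sum>k\<in>{m<..n}. B)"
      using bound by (intro sum_mono) auto
    finally show ?thesis by simp
  qed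
  have "0 \<le> (\<integral>x. (W 1 x)\<^sup>2 \<partial>M)"
    by simp
  also have "\<dots> \<le> B"
    by (rule bound) simp
  finally have B: "0 \<le> B" .
  \<comment> \<open>\<open>T j\<close> dominates \<open>(S\<^sub>m / m)\<^sup>2\<close>, up to a factor 2, for every \<open>m\<close> in the \<open>j\<close>-th block.\<close>
  define T where
    "T j x = ((S 0 (j\<^sup>2) x)\<^sup>2 + (\<Sum>m\<in>{j\<^sup>2..<(j + 1)\<^sup>2}. (S (j\<^sup>2) m x)\<^sup>2)) / real j ^ 4" for j x
  have T_nonneg: "0 \<le> T j x" for j x
    unfolding T_def by (intro divide_nonneg_nonneg add_nonneg_nonneg sum_nonneg) auto
  have T_int: "integrable M (T j)" for j
    unfolding T_def by (intro integrable_divide Bochner_Integration.integrable_add Bochner_Integration.integrable_sum S_int)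
  have T_bound: "(\<integral>x. T j x \<partial>M) \<le> 10 * B * inverse (real j ^ 2)" for j
  proof (cases "j = 0")
    case False
    have "(\<integral>x. T j x \<partial>M) = ((\<integral>x. (S 0 (j\<^sup>2) x)\<^sup>2 \<partial>M)
        + (\<Sum>m\<in>{j\<^sup>2..<(j + 1)\<^sup>2}. \<integral>x. (S (j\<^sup>2) m x)\<^sup>2 \<partial>M)) / real j ^ 4"
      unfolding T_def
      by (simp add: S_int Bochner_Integration.integral_add Bochner_Integration.integral_sum
          Bochner_Integration.integrable_sum)
    also have "\<dots> \<le> (real (j\<^sup>2) * B + (\<Sum>m\<in>{j\<^sup>2..<(j + 1)\<^sup>2}. real (2 * j + 1) * B)) / real j ^ 4"
    proof (intro divide_right_mono add_mono sum_mono)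
      show "(\<integral>x. (S 0 (j\<^sup>2) x)\<^sup>2 \<partial>M) \<le> real (j\<^sup>2) * B"
        using S_bound[of 0 "j\<^sup>2"] by simp
      fix m assume m: "m \<in> {j\<^sup>2..<(j + 1)\<^sup>2}"
      then have "m - j\<^sup>2 \<le> 2 * j + 1"
        by (auto simp: power2_eq_square)
      then have "real (m - j\<^sup>2) * B \<le> real (2 * j + 1) * B"
        using B by (intro mult_right_mono of_nat_mono)
      with S_bound[of "j\<^sup>2" m] show "(\<integral>x. (S (j\<^sup>2) m x)\<^sup>2 \<partial>M) \<le> real (2 * j + 1) * B"
        by linarith
    qed auto
    also have "\<dots> = (real j ^ 2 + (2 * real j + 1)\<^sup>2) * B / real j ^ 4"
      by (simp add: power2_eq_square algebra_simps)
    also have "\<dots> \<le> 10 * real j ^ 2 * B / real j ^ 4"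
    proof -
      have "(2 * real j + 1)\<^sup>2 \<le> (3 * real j)\<^sup>2"
        using False by (intro power_mono) auto
      then have "real j ^ 2 + (2 * real j + 1)\<^sup>2 \<le> 10 * real j ^ 2"
        by (simp add: power_mult_distrib)
      then show ?thesis
        using B by (intro divide_right_mono mult_right_mono) auto
    qed
    also have "\<dots> = 10 * B * inverse (real j ^ 2)"
      using False by (simp add: field_simps power4_eq_xxxx power2_eq_square)
    finally show ?thesis .
  qed (simp add: T_def)
  have "summable (\<lambda>j. 10 * B * inverse (real j ^ 2))"
    by (intro summable_mult inverse_power_summable) auto
  then have "summable (\<lambda>j. \<integral>x. T j x \<partial>M)"
    by (rule summable_comparison_test'[where N = 0]) (use T_bound T_nonneg in \<open>simp add: integral_nonneg\<close>)
  then have "AE x in M. (\<lambda>j. T j x) \<longlonglongrightarrow> 0"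
    using T_nonneg T_int by (intro AE_tendsto_zero_if_summable_integrals)
  then show ?thesis
  proof eventually_elim
    case (elim x)
    have sqrt_top: "filterlim floor_sqrt at_top sequentially"
      unfolding filterlim_at_top eventually_sequentially
      by (meson le_floor_sqrt_iff le_trans)
    have key: "(S 0 m x / real m)\<^sup>2 \<le> 2 * T (floor_sqrt m) x" if "m \<ge> 1" for m
    proof -
      define j where "j = floor_sqrt m"
      have j: "j\<^sup>2 \<le> m" "m < (j + 1)\<^sup>2"
        using Suc_floor_sqrt_power2_gt[of m] by (simp_all add: j_def)
      have "j \<ge> 1"
        using j(2) that by (cases j) auto
      have "S 0 m x = S 0 (j\<^sup>2) x + S (j\<^sup>2) m x"
        unfolding S_def using j(1) by (subst sum.union_disjoint[symmetric]) (auto intro!: sum.cong)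
      then have "(S 0 m x)\<^sup>2 \<le> 2 * ((S 0 (j\<^sup>2) x)\<^sup>2 + (S (j\<^sup>2) m x)\<^sup>2)"
        using sum_squares_bound[of "S 0 (j\<^sup>2) x" "S (j\<^sup>2) m x"] by (simp add: power2_sum)
      also have "(S (j\<^sup>2) m x)\<^sup>2 \<le> (\<Sum>m\<in>{j\<^sup>2..<(j + 1)\<^sup>2}. (S (j\<^sup>2) m x)\<^sup>2)"
        using j by (intro member_le_sum) auto
      finally have "(S 0 m x)\<^sup>2 \<le> 2 * real j ^ 4 * T j x"
        using \<open>j \<ge> 1\<close> by (simp add: T_def)
      also have "\<dots> \<le> 2 * (real m)\<^sup>2 * T j x"
      proof -
        have "(real (j\<^sup>2))\<^sup>2 \<le> (real m)\<^sup>2"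
          using j(1) by (intro power_mono of_nat_mono) auto
        then show ?thesis
          using T_nonneg[of j x] by (intro mult_right_mono mult_left_mono) (auto simp flip: power_mult)
      qed
      finally show ?thesis
        using that by (simp add: j_def power_divide field_simps)
    qed
    have "(\<lambda>m. 2 * T (floor_sqrt m) x) \<longlonglongrightarrow> 0"
      using filterlim_compose[OF elim sqrt_top] by (rule tendsto_mult_right_zero)
    then have "(\<lambda>m. (S 0 m x / real m)\<^sup>2) \<longlonglongrightarrow> 0"
      by (rule metric_tendsto_imp_tendsto)
        (use key in \<open>auto intro!: eventually_sequentiallyI[of 1] simp: T_nonneg\<close>)
    then have "(\<lambda>m. S 0 m x / real m) \<longlonglongrightarrow> 0"
      by (subst (asm) power_tendsto_0_iff) auto
    moreover have "S 0 m x = (\<Sum>k=1..m. W k x)" for m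
      unfolding S_def by (intro sum.cong) auto
    ultimately show ?case
      by (simp add: smallo_real_iff)
  qed
qed

section \<open>White noise\<close>

text \<open>
  The indices start at 1 because time 0 carries the initial value of the process, which may depend
  on the noise.
\<close>

locale white_noise = prob_space M
  for M :: "'a measure" +
  fixes V :: "nat \<Rightarrow> 'a \<Rightarrow> real" and s :: real
  assumes indep: "indep_vars (\<lambda>_. borel) V {1..}"
    and square_integrable: "\<And>k. k \<ge> 1 \<Longrightarrow> integrable M (\<lambda>\<omega>. (V k \<omega>)\<^sup>2)"
    and mean_zero: "\<And>k. k \<ge> 1 \<Longrightarrow> expectation (V k) = 0"
    and second_moment: "\<And>k. k \<ge> 1 \<Longrightarrow> expectation (\<lambda>\<omega>. (V k \<omega>)\<^sup>2) = s"
begin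

lemma measurable_noise: "k \<ge> 1 \<Longrightarrow> V k \<in> borel_measurable M"
  using indep by (auto simp: indep_vars_def)

lemma integrable_noise: "k \<ge> 1 \<Longrightarrow> integrable M (V k)"
  by (rule square_integrable_imp_integrable[OF measurable_noise square_integrable])

text \<open>
  The past enters through a function \<open>F\<close> of the tuple \<open>V\<^sub>1, \<dots>, V\<^sub>k\<^sub>-\<^sub>1\<close>, in place of a
  filtration, since every past-dependent variable below is an explicit polynomial in that tuple.
\<close>

lemma indep_past_present:
  assumes "F \<in> borel_measurable (PiM {1..<k} (\<lambda>_. borel))" "G \<in> borel_measurable borel" "k \<ge> 1"
  shows "indep_var borel (\<lambda>\<omega>. F (\<lambda>i\<in>{1..<k}. V i \<omega>)) borel (\<lambda>\<omega>. G (V k \<omega>))"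
proof -
  have "indep_var (PiM {1..<k} (\<lambda>_. borel)) (\<lambda>\<omega>. \<lambda>i\<in>{1..<k}. V i \<omega>)
      (PiM {k} (\<lambda>_. borel)) (\<lambda>\<omega>. \<lambda>i\<in>{k}. V i \<omega>)"
    using \<open>k \<ge> 1\<close> by (intro indep_var_restrict[OF indep]) auto
  moreover have "(\<lambda>x. G (x k)) \<in> borel_measurable (PiM {k} (\<lambda>_. borel))"
    using assms(2) by measurable
  ultimately have "indep_var borel (F \<circ> (\<lambda>\<omega>. \<lambda>i\<in>{1..<k}. V i \<omega>))
      borel ((\<lambda>x. G (x k)) \<circ> (\<lambda>\<omega>. \<lambda>i\<in>{k}. V i \<omega>))"
    using assms(1) by (intro indep_var_compose)
  then show ?thesis
    by (simp add: comp_def)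
qed

lemma expectation_past_times_noise:
  assumes "F \<in> borel_measurable (PiM {1..<k} (\<lambda>_. borel))" "k \<ge> 1"
    and "integrable M (\<lambda>\<omega>. F (\<lambda>i\<in>{1..<k}. V i \<omega>))"
  shows "expectation (\<lambda>\<omega>. F (\<lambda>i\<in>{1..<k}. V i \<omega>) * V k \<omega>) = 0"
proof -
  have "indep_var borel (\<lambda>\<omega>. F (\<lambda>i\<in>{1..<k}. V i \<omega>)) borel (\<lambda>\<omega>. V k \<omega>)"
    by (rule indep_past_present[where G = "\<lambda>y. y"]) (use assms in auto)
  then have "expectation (\<lambda>\<omega>. F (\<lambda>i\<in>{1..<k}. V i \<omega>) * V k \<omega>) =
      expectation (\<lambda>\<omega>. F (\<lambda>i\<in>{1..<k}. V i \<omega>)) * expectation (V k)"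
    by (rule indep_var_lebesgue_integral[OF _ assms(3) integrable_noise[OF assms(2)]])
  then show ?thesis
    using mean_zero[OF assms(2)] by simp
qed

lemma orthogonal_noise:
  assumes "1 \<le> i" "1 \<le> j" "i \<noteq> j"
  shows "expectation (\<lambda>\<omega>. V i \<omega> * V j \<omega>) = 0"
proof -
  have *: "expectation (\<lambda>\<omega>. V i \<omega> * V j \<omega>) = 0" if "1 \<le> i" "i < j" for i j
    using expectation_past_times_noise[of "\<lambda>x. x i" j] that integrable_noise[of i]
    by (auto simp: measurable_component_singleton)
  show ?thesis
    using *[of i j] *[of j i] assms by (cases i j rule: linorder_cases) (auto simp: mult.commute)
qed

lemma
  fixes c :: "nat \<Rightarrow> nat \<Rightarrow> real"
  defines "U \<equiv> \<lambda>k \<omega>. \<Sum>i\<in>{1..<k}. c k i * V i \<omega>"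
  assumes "k \<ge> 1"
  shows measurable_predictor: "U k \<in> borel_measurable M"
    and square_integrable_predictor: "integrable M (\<lambda>\<omega>. (U k \<omega>)\<^sup>2)"
    and second_moment_predictor: "expectation (\<lambda>\<omega>. (U k \<omega>)\<^sup>2) = s * (\<Sum>i\<in>{1..<k}. (c k i)\<^sup>2)"
proof -
  show "U k \<in> borel_measurable M"
    unfolding U_def by (auto intro!: borel_measurable_sum borel_measurable_times measurable_noise)
  have meas: "(\<lambda>\<omega>. c k i * V i \<omega>) \<in> borel_measurable M"
    and sq: "integrable M (\<lambda>\<omega>. (c k i * V i \<omega>)\<^sup>2)" if "i \<in> {1..<k}" for i
    using that measurable_noise square_integrable by (auto simp: power_mult_distrib)
  have orth: "expectation (\<lambda>\<omega>. c k i * V i \<omega> * (c k j * V j \<omega>)) = 0"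
    if "i \<in> {1..<k}" "j \<in> {1..<k}" "i \<noteq> j" for i j
  proof -
    have "expectation (\<lambda>\<omega>. c k i * c k j * (V i \<omega> * V j \<omega>)) = 0"
      using that orthogonal_noise[of i j] by simp
    then show ?thesis
      by (simp add: mult_ac)
  qed
  show "integrable M (\<lambda>\<omega>. (U k \<omega>)\<^sup>2)"
    unfolding U_def by (rule integrable_square_sum) (use meas sq orth in auto)
  have "expectation (\<lambda>\<omega>. (U k \<omega>)\<^sup>2) = (\<Sum>i\<in>{1..<k}. expectation (\<lambda>\<omega>. (c k i * V i \<omega>)\<^sup>2))"
    unfolding U_def by (rule integral_square_sum_orthogonal) (use meas sq orth in auto)
  also have "\<dots> = (\<Sum>i\<in>{1..<k}. (c k i)\<^sup>2 * s)"
    by (intro sum.cong) (auto simp: power_mult_distrib second_moment)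
  finally show "expectation (\<lambda>\<omega>. (U k \<omega>)\<^sup>2) = s * (\<Sum>i\<in>{1..<k}. (c k i)\<^sup>2)"
    by (simp add: sum_distrib_left mult.commute)
qed

text \<open>
  This takes the place of a strong law for martingales: each term is the present noise times a
  linear function of the past, so the terms are orthogonal, and by independence their second
  moments are products of two second moments and hence bounded.
\<close>

lemma AE_predictable_sum_smallo:
  fixes c :: "nat \<Rightarrow> nat \<Rightarrow> real"
  assumes bound: "\<And>k. (\<Sum>i\<in>{1..<k}. (c k i)\<^sup>2) \<le> B"
  shows "AE \<omega> in M. (\<lambda>n. \<Sum>k=1..n. (\<Sum>i\<in>{1..<k}. c k i * V i \<omega>) * V k \<omega>) \<in> o(real)"
proof -
  define U where "U k \<omega> = (\<Sum>i\<in>{1..<k}. c k i * V i \<omega>)" for k \<omega>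
  define F where "F k x = (\<Sum>i\<in>{1..<k}. c k i * x i)" for k and x :: "nat \<Rightarrow> real"
  have F_meas [measurable]: "F k \<in> borel_measurable (PiM {1..<l} (\<lambda>_. borel))" if "k \<le> l" for k l
    unfolding F_def using that
    by (auto intro!: borel_measurable_sum borel_measurable_times measurable_component_singleton)
  have U_eq: "U k \<omega> = F k (\<lambda>i\<in>{1..<l}. V i \<omega>)" if "k \<le> l" for k l \<omega>
    unfolding U_def F_def using that by (intro sum.cong) auto
  have U_meas: "U k \<in> borel_measurable M"
    and U_sq: "integrable M (\<lambda>\<omega>. (U k \<omega>)\<^sup>2)"
    and U_second: "expectation (\<lambda>\<omega>. (U k \<omega>)\<^sup>2) = s * (\<Sum>i\<in>{1..<k}. (c k i)\<^sup>2)" if "k \<ge> 1" for k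
    using measurable_predictor[OF that, of c] square_integrable_predictor[OF that, of c]
      second_moment_predictor[OF that, of c]
    unfolding U_def by auto
  have indep: "indep_var borel (\<lambda>\<omega>. (U k \<omega>)\<^sup>2) borel (\<lambda>\<omega>. (V k \<omega>)\<^sup>2)" if "k \<ge> 1" for k
    using indep_past_present[of "\<lambda>x. (F k x)\<^sup>2" k "\<lambda>y. y\<^sup>2"] F_meas[of k k] that
    by (simp add: U_eq[of k k])
  have W_sq: "integrable M (\<lambda>\<omega>. (U k \<omega> * V k \<omega>)\<^sup>2)" if "k \<ge> 1" for k
    using indep_var_integrable[OF indep U_sq square_integrable] that
    by (simp add: power_mult_distrib)
  have W_meas: "(\<lambda>\<omega>. U k \<omega> * V k \<omega>) \<in> borel_measurable M" if "k \<ge> 1" for k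
    using U_meas measurable_noise that by simp
  have "s \<ge> 0"
    using second_moment[of 1] Bochner_Integration.integral_nonneg[of M "\<lambda>\<omega>. (V 1 \<omega>)\<^sup>2"] by simp
  have "AE \<omega> in M. (\<lambda>n. \<Sum>k=1..n. U k \<omega> * V k \<omega>) \<in> o(real)"
  proof (rule AE_sum_orthogonal_smallo)
    fix k :: nat assume k: "k \<ge> 1"
    have "expectation (\<lambda>\<omega>. (U k \<omega> * V k \<omega>)\<^sup>2) = s * (\<Sum>i\<in>{1..<k}. (c k i)\<^sup>2) * s"
      using indep_var_lebesgue_integral[OF indep U_sq square_integrable] U_second second_moment k
      by (simp add: power_mult_distrib)
    also have "\<dots> \<le> s * B * s"
      using bound \<open>s \<ge> 0\<close> by (intro mult_right_mono mult_left_mono)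
    finally show "expectation (\<lambda>\<omega>. (U k \<omega> * V k \<omega>)\<^sup>2) \<le> s * B * s" .
  next
    fix k l :: nat assume kl: "1 \<le> l" "l < k"
    \<comment> \<open>For \<open>l < k\<close> the product \<open>W\<^sub>k W\<^sub>l\<close> is \<open>V\<^sub>k\<close> times \<open>U\<^sub>k (U\<^sub>l V\<^sub>l)\<close>, which depends on \<open>V\<^sub>1, \<dots>, V\<^sub>k\<^sub>-\<^sub>1\<close> only.\<close>
    have "expectation (\<lambda>\<omega>. F k (\<lambda>i\<in>{1..<k}. V i \<omega>) * (F l (\<lambda>i\<in>{1..<k}. V i \<omega>) * (\<lambda>i\<in>{1..<k}. V i \<omega>) l)
        * V k \<omega>) = 0"
    proof (rule expectation_past_times_noise[of "\<lambda>x. F k x * (F l x * x l)"])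
      show "(\<lambda>x. F k x * (F l x * x l)) \<in> borel_measurable (PiM {1..<k} (\<lambda>_. borel))"
        using kl by (intro borel_measurable_times F_meas measurable_component_singleton) auto
      have "integrable M (\<lambda>\<omega>. U k \<omega> * (U l \<omega> * V l \<omega>))"
        using U_meas U_sq W_sq W_meas kl by (intro integrable_mult_if_squares) auto
      then show "integrable M (\<lambda>\<omega>. F k (\<lambda>i\<in>{1..<k}. V i \<omega>) * (F l (\<lambda>i\<in>{1..<k}. V i \<omega>) * (\<lambda>i\<in>{1..<k}. V i \<omega>) l))"
        using kl by (simp add: U_eq[of k k] U_eq[of l k])
    qed (use kl in auto)
    then show "expectation (\<lambda>\<omega>. U k \<omega> * V k \<omega> * (U l \<omega> * V l \<omega>)) = 0"
      using kl by (simp add: U_eq[of k k] U_eq[of l k] mult_ac)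
  qed (use W_meas W_sq in auto)
  then show ?thesis
    by (simp add: U_def)
qed

end

locale iid_white_noise = white_noise +
  assumes identical: "\<And>k. k \<ge> 1 \<Longrightarrow> distr M borel (V k) = distr M borel (V 1)"
begin

lemma expectation_identical:
  assumes "k \<ge> 1" "G \<in> borel_measurable borel"
  shows "expectation (\<lambda>\<omega>. G (V k \<omega>)) = expectation (\<lambda>\<omega>. G (V 1 \<omega>) :: real)"
proof -
  have "expectation (\<lambda>\<omega>. G (V k \<omega>)) = integral\<^sup>L (distr M borel (V k)) G"
    using assms measurable_noise by (intro integral_distr[symmetric]) auto
  also have "\<dots> = integral\<^sup>L (distr M borel (V 1)) G"
    using identical[OF \<open>k \<ge> 1\<close>] by simp
  also have "\<dots> = expectation (\<lambda>\<omega>. G (V 1 \<omega>))"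
    using measurable_noise[of 1] assms by (intro integral_distr) auto
  finally show ?thesis .
qed

text \<open>
  For every \<open>c > 0\<close> the probabilities \<open>P(k < c V\<^sub>k\<^sup>2) = P(k < c V\<^sub>1\<^sup>2)\<close> add up to at most
  \<open>c E(V\<^sub>1\<^sup>2)\<close>, because at most \<open>y\<close> integers \<open>k \<ge> 1\<close> lie below a number \<open>y \<ge> 0\<close>; the claim is then
  the Borel-Cantelli lemma.
\<close>

lemma AE_noise_square_smallo: "AE \<omega> in M. (\<lambda>k. (V k \<omega>)\<^sup>2) \<in> o(real)"
proof -
  have rare: "AE \<omega> in M. eventually (\<lambda>k. \<not> (real k < c * (V k \<omega>)\<^sup>2)) sequentially" if "c > 0" for c
  proof -
    define A where "A k = {\<omega> \<in> space M. real k < c * (V k \<omega>)\<^sup>2}" for k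
    define g :: "nat \<Rightarrow> real \<Rightarrow> real" where "g k y = indicator {y. real k < c * y\<^sup>2} y" for k y
    have g_meas [measurable]: "g k \<in> borel_measurable borel" for k
      unfolding g_def by measurable
    have g_int: "integrable M (\<lambda>\<omega>. g k (V 1 \<omega>))" for k
    proof (rule integrable_const_bound[where B = 1])
      show "(\<lambda>\<omega>. g k (V 1 \<omega>)) \<in> borel_measurable M"
        using measurable_noise[of 1] by measurable
    qed (auto simp: g_def)
    have bound: "(\<Sum>k=1..n. prob (A k)) \<le> c * s" for n
    proof -
      have "(\<Sum>k=1..n. prob (A k)) = (\<Sum>k=1..n. expectation (\<lambda>\<omega>. g k (V 1 \<omega>)))"
      proof (intro sum.cong refl)
        fix k assume "k \<in> {1..n}"
        then have [measurable]: "V k \<in> borel_measurable M" and "k \<ge> 1"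
          using measurable_noise by auto
        have "prob (A k) = expectation (indicator (A k))"
          by (simp add: A_def)
        also have "\<dots> = expectation (\<lambda>\<omega>. g k (V k \<omega>))"
          by (intro Bochner_Integration.integral_cong) (auto simp: A_def g_def split: split_indicator)
        also have "\<dots> = expectation (\<lambda>\<omega>. g k (V 1 \<omega>))"
          by (rule expectation_identical[OF \<open>k \<ge> 1\<close> g_meas])
        finally show "prob (A k) = expectation (\<lambda>\<omega>. g k (V 1 \<omega>))" .
      qed
      also have "\<dots> = expectation (\<lambda>\<omega>. \<Sum>k=1..n. g k (V 1 \<omega>))"
        by (subst Bochner_Integration.integral_sum) (use g_int in auto)
      also have "\<dots> \<le> expectation (\<lambda>\<omega>. c * (V 1 \<omega>)\<^sup>2)"
      proof (rule integral_mono)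
        fix \<omega>
        have "(\<Sum>k=1..n. g k y) \<le> c * y\<^sup>2" for y
        proof -
          have "(\<Sum>k=1..n. g k y) = real (card {k\<in>{1..n}. real k < c * y\<^sup>2})"
            unfolding g_def by (simp add: indicator_def sum.If_cases Int_def)
          also have "card {k\<in>{1..n}. real k < c * y\<^sup>2} \<le> card {1..nat \<lfloor>c * y\<^sup>2\<rfloor>}"
            by (intro card_mono) (auto simp: le_nat_floor)
          also have "real (card {1..nat \<lfloor>c * y\<^sup>2\<rfloor>}) \<le> c * y\<^sup>2"
            using \<open>c > 0\<close> by simp
          finally show ?thesis by simp
        qed
        then show "(\<Sum>k=1..n. g k (V 1 \<omega>)) \<le> c * (V 1 \<omega>)\<^sup>2" .
      qed (use square_integrable[of 1] g_int in auto)
      also have "\<dots> = c * s"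
        by (simp add: second_moment)
      finally show ?thesis .
    qed
    have "summable (\<lambda>k. prob (A (Suc k)))"
    proof (rule summableI_nonneg_bounded)
      show "(\<Sum>k<n. prob (A (Suc k))) \<le> c * s" for n
        using bound[of n] by (simp add: sum.atLeast1_atMost_eq)
    qed simp
    then have "AE \<omega> in M. eventually (\<lambda>k. \<omega> \<in> space M - A (Suc k)) sequentially"
      using measurable_noise
      by (intro borel_cantelli_AE1) (auto simp: A_def emeasure_eq_measure)
    then show ?thesis
      by (rule AE_mp) (intro AE_I2 impI, subst eventually_sequentially_Suc[symmetric], auto simp: A_def elim: eventually_mono)
  qed
  have "AE \<omega> in M. \<forall>m. eventually (\<lambda>k. \<not> (real k < real (Suc m) * (V k \<omega>)\<^sup>2)) sequentially"
    unfolding AE_all_countable using rare by auto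
  then show ?thesis
  proof eventually_elim
    case (elim \<omega>)
    show ?case
    proof (rule landau_o.smallI)
      fix c :: real assume "c > 0"
      then obtain m where m: "inverse (real (Suc m)) < c"
        using reals_Archimedean by blast
      show "eventually (\<lambda>k. norm ((V k \<omega>)\<^sup>2) \<le> c * norm (real k)) sequentially"
        using spec[OF elim, of m]
      proof eventually_elim
        case (elim k)
        then have "(V k \<omega>)\<^sup>2 \<le> inverse (real (Suc m)) * real k"
          by (simp add: field_simps)
        also have "\<dots> \<le> c * real k"
          using m by (intro mult_right_mono) auto
        finally show ?case by simp
      qed
    qed
  qed
qed

text \<open>
  The squares \<open>V\<^sub>k\<^sup>2\<close> need not have second moments, but their truncations at 1 do, and these obey
  the law for orthogonal sequences after centring. Truncation can only decrease the sum, and the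
  mean of the truncated square stays positive, so a lower bound survives.
\<close>

lemma AE_noise_energy_lower_bound:
  assumes "s > 0"
  shows "AE \<omega> in M. \<exists>c>0. eventually (\<lambda>n. c * real n \<le> (\<Sum>k=1..n. (V k \<omega>)\<^sup>2)) sequentially"
proof -
  define g :: "real \<Rightarrow> real" where "g y = min (y\<^sup>2) 1" for y
  have g_meas [measurable]: "g \<in> borel_measurable borel"
    unfolding g_def by measurable
  have g_bounds: "0 \<le> g y" "g y \<le> 1" for y
    by (auto simp: g_def)
  define \<mu> where "\<mu> = expectation (\<lambda>\<omega>. g (V 1 \<omega>))"
  define W where "W k \<omega> = g (V k \<omega>) - \<mu>" for k \<omega>
  have int_g: "integrable M (\<lambda>\<omega>. g (V k \<omega>))" if "k \<ge> 1" for k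
    using measurable_noise[OF that] g_bounds
    by (intro integrable_const_bound[where B = 1]) auto
  have mean_W: "expectation (W k) = 0" if "k \<ge> 1" for k
    using int_g[OF that] expectation_identical[OF that g_meas] by (simp add: W_def[abs_def] \<mu>_def prob_space)
  have "\<mu> \<ge> 0"
    unfolding \<mu>_def using g_bounds by (intro Bochner_Integration.integral_nonneg) auto
  moreover have "\<mu> \<noteq> 0"
  proof
    assume "\<mu> = 0"
    then have "AE \<omega> in M. g (V 1 \<omega>) = 0"
      using int_g[of 1] g_bounds integral_nonneg_eq_0_iff_AE[of M "\<lambda>\<omega>. g (V 1 \<omega>)"] by (auto simp: \<mu>_def)
    then have "AE \<omega> in M. (V 1 \<omega>)\<^sup>2 = 0"
      by eventually_elim (auto simp: g_def min_def split: if_splits)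
    then have "expectation (\<lambda>\<omega>. (V 1 \<omega>)\<^sup>2) = 0"
      by (subst integral_cong_AE[where g = "\<lambda>_. 0"]) (use measurable_noise[of 1] in auto)
    with second_moment[of 1] \<open>s > 0\<close> show False by simp
  qed
  ultimately have "\<mu> > 0" by simp
  have "\<mu> \<le> 1"
    unfolding \<mu>_def using g_bounds int_g[of 1] integral_mono[of M "\<lambda>\<omega>. g (V 1 \<omega>)" "\<lambda>_. 1"]
    by (simp add: prob_space)
  have W_bounds: "\<bar>W k \<omega>\<bar> \<le> 1" for k \<omega>
    using g_bounds[of "V k \<omega>"] \<open>\<mu> \<ge> 0\<close> \<open>\<mu> \<le> 1\<close> by (auto simp: W_def)
  have W_meas: "W k \<in> borel_measurable M" if "k \<ge> 1" for k
    unfolding W_def using measurable_noise[OF that] by measurable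
  have W_sq_le: "(W k \<omega>)\<^sup>2 \<le> 1" for k \<omega>
    using W_bounds[of k \<omega>] by (simp add: abs_square_le_1)
  have W_sq: "integrable M (\<lambda>\<omega>. (W k \<omega>)\<^sup>2)" if "k \<ge> 1" for k
    using W_meas[OF that] W_sq_le by (intro integrable_const_bound[where B = 1]) auto
  have W_int: "integrable M (W k)" if "k \<ge> 1" for k
    using W_meas[OF that] W_bounds by (intro integrable_const_bound[where B = 1]) auto
  have "AE \<omega> in M. (\<lambda>n. \<Sum>k=1..n. W k \<omega>) \<in> o(real)"
  proof (rule AE_sum_orthogonal_smallo)
    fix k :: nat assume "k \<ge> 1"
    then show "expectation (\<lambda>\<omega>. (W k \<omega>)\<^sup>2) \<le> 1"
      using integral_mono[of M "\<lambda>\<omega>. (W k \<omega>)\<^sup>2" "\<lambda>_. 1"] W_sq W_sq_le by (simp add: prob_space)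
  next
    fix k l :: nat assume kl: "1 \<le> l" "l < k"
    have "indep_var borel (W l) borel (W k)"
      using indep_past_present[of "\<lambda>x. g (x l) - \<mu>" k "\<lambda>y. g y - \<mu>"] kl by (simp add: W_def[abs_def])
    then have "expectation (\<lambda>\<omega>. W l \<omega> * W k \<omega>) = expectation (W l) * expectation (W k)"
      using kl by (intro indep_var_lebesgue_integral W_int) auto
    then show "expectation (\<lambda>\<omega>. W k \<omega> * W l \<omega>) = 0"
      using kl by (simp add: mean_W mult.commute)
  qed (use W_meas W_sq in auto)
  then show ?thesis
  proof eventually_elim
    case (elim \<omega>)
    have "eventually (\<lambda>n. \<bar>\<Sum>k=1..n. W k \<omega>\<bar> \<le> \<mu> / 2 * real n) sequentially"
      using landau_o.smallD[OF elim, of "\<mu> / 2"] \<open>\<mu> > 0\<close> by simp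
    then have "eventually (\<lambda>n. \<mu> / 2 * real n \<le> (\<Sum>k=1..n. (V k \<omega>)\<^sup>2)) sequentially"
    proof eventually_elim
      case (elim n)
      have "\<mu> * real n + (\<Sum>k=1..n. W k \<omega>) = (\<Sum>k=1..n. g (V k \<omega>))"
        by (simp add: W_def sum_subtractf)
      also have "\<dots> \<le> (\<Sum>k=1..n. (V k \<omega>)\<^sup>2)"
        by (intro sum_mono) (simp add: g_def)
      finally show ?case
        using elim by (simp add: abs_le_iff field_simps)
    qed
    then show ?case
      using \<open>\<mu> > 0\<close> by (intro exI[of _ "\<mu> / 2"]) auto
  qed
qed

end

section \<open>Sublinear sequences\<close>

text \<open>
  Each row of weights has total mass at most \<open>B\<close>, and \<open>\<bar>w\<bar>\<close> is at most \<open>e n + C\<close> on \<open>{..n}\<close> for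
  every \<open>e > 0\<close>, with \<open>C\<close> depending on \<open>e\<close> alone.
\<close>

lemma sum_weighted_smallo:
  fixes w :: "nat \<Rightarrow> real" and a :: "nat \<Rightarrow> nat \<Rightarrow> real"
  assumes w: "w \<in> o(real)" and a: "\<And>n. (\<Sum>i\<le>n. \<bar>a n i\<bar>) \<le> B"
  shows "(\<lambda>n. \<Sum>i\<le>n. a n i * w i) \<in> o(real)"
proof (rule landau_o.smallI)
  fix c :: real assume "c > 0"
  have "0 \<le> (\<Sum>i\<le>0. \<bar>a 0 i\<bar>)" by simp
  then have "B \<ge> 0" using a[of 0] by linarith
  define e where "e = c / (2 * (B + 1))"
  have "e > 0" using \<open>c > 0\<close> \<open>B \<ge> 0\<close> by (simp add: e_def)
  have "eventually (\<lambda>n. \<bar>w n\<bar> \<le> e * real n) sequentially"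
    using landau_o.smallD[OF w \<open>e > 0\<close>] by simp
  then obtain N where N: "\<And>n. n \<ge> N \<Longrightarrow> \<bar>w n\<bar> \<le> e * real n"
    by (auto simp: eventually_sequentially)
  define C where "C = (\<Sum>i<N. \<bar>w i\<bar>)"
  have "C \<ge> 0" by (simp add: C_def sum_nonneg)
  have w_le: "\<bar>w i\<bar> \<le> e * real n + C" if "i \<le> n" for i n
  proof (cases "i < N")
    case True
    then have "\<bar>w i\<bar> \<le> C"
      unfolding C_def by (intro member_le_sum[where f = "\<lambda>i. \<bar>w i\<bar>"]) auto
    then show ?thesis
      using \<open>e > 0\<close> by (simp add: add_increasing)
  next
    case False
    then have "\<bar>w i\<bar> \<le> e * real i"
      using N by simp
    also have "\<dots> \<le> e * real n"
      using that \<open>e > 0\<close> by simp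
    finally show ?thesis
      using \<open>C \<ge> 0\<close> by simp
  qed
  show "eventually (\<lambda>n. norm (\<Sum>i\<le>n. a n i * w i) \<le> c * norm (real n)) sequentially"
  proof (rule eventually_sequentiallyI)
    fix n assume n: "n \<ge> nat \<lceil>C / e\<rceil>"
    have "C / e \<le> real n"
      using n by linarith
    then have "C \<le> e * real n"
      using \<open>e > 0\<close> by (simp add: field_simps)
    have "\<bar>\<Sum>i\<le>n. a n i * w i\<bar> \<le> (\<Sum>i\<le>n. \<bar>a n i\<bar> * \<bar>w i\<bar>)"
      by (rule order_trans[OF sum_abs]) (simp add: abs_mult)
    also have "\<dots> \<le> (\<Sum>i\<le>n. \<bar>a n i\<bar> * (e * real n + C))"
      using w_le by (intro sum_mono mult_left_mono) auto
    also have "\<dots> = (\<Sum>i\<le>n. \<bar>a n i\<bar>) * (e * real n + C)"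
      by (simp add: sum_distrib_right)
    also have "\<dots> \<le> B * (2 * e * real n)"
      using a[of n] \<open>C \<le> e * real n\<close> \<open>B \<ge> 0\<close> \<open>e > 0\<close> \<open>C \<ge> 0\<close> by (intro mult_mono) auto
    also have "\<dots> \<le> (B + 1) * (2 * e * real n)"
      using \<open>e > 0\<close> by (intro mult_right_mono) auto
    also have "\<dots> = c * real n"
      using \<open>B \<ge> 0\<close> by (simp add: e_def field_simps)
    finally show "norm (\<Sum>i\<le>n. a n i * w i) \<le> c * norm (real n)"
      by simp
  qed
qed

lemma const_smallo_real: "(\<lambda>_. c) \<in> o(real)" for c :: real
  unfolding smallo_real_iff by (rule lim_const_over_n)

lemma cmult_smallo_real: "f \<in> o(real) \<Longrightarrow> (\<lambda>n. c * f n) \<in> o(real)" for f :: "nat \<Rightarrow> real"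
  by (cases "c = 0") auto

lemma smallo_real_Suc:
  fixes f :: "nat \<Rightarrow> real"
  assumes "(\<lambda>n. f (Suc n)) \<in> o(real)"
  shows "f \<in> o(real)"
proof -
  have "(\<lambda>n. f (Suc n) / real (Suc n)) \<longlonglongrightarrow> 0"
  proof (rule metric_tendsto_imp_tendsto)
    show "(\<lambda>n. f (Suc n) / real n) \<longlonglongrightarrow> 0"
      using assms by (simp add: smallo_real_iff)
    show "eventually (\<lambda>n. dist (f (Suc n) / real (Suc n)) 0 \<le> dist (f (Suc n) / real n) 0) sequentially"
      by (rule eventually_sequentiallyI[of 1]) (auto intro!: divide_left_mono)
  qed
  then have "(\<lambda>n. f n / real n) \<longlonglongrightarrow> 0"
    by (rule LIMSEQ_imp_Suc)
  then show ?thesis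
    by (simp add: smallo_real_iff)
qed

lemma smallo_real_le:
  fixes f g :: "nat \<Rightarrow> real"
  assumes "g \<in> o(real)" "\<And>n. \<bar>f n\<bar> \<le> g n"
  shows "f \<in> o(real)"
proof -
  have "f \<in> O(g)"
    by (intro landau_o.bigI[of 1] always_eventually) (auto intro: order_trans[OF assms(2) abs_ge_self])
  then show ?thesis
    using assms(1) by (rule landau_o.big_small_trans)
qed

lemma smallo_real_if_square:
  fixes f :: "nat \<Rightarrow> real"
  assumes "(\<lambda>n. (f n)\<^sup>2) \<in> o(real)"
  shows "f \<in> o(real)"
proof (rule smallo_real_le)
  show "(\<lambda>n. (f n)\<^sup>2 + 1) \<in> o(real)"
    by (intro sum_in_smallo assms const_smallo_real)
  show "\<bar>f n\<bar> \<le> (f n)\<^sup>2 + 1" for n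
    using sum_squares_bound[of "\<bar>f n\<bar>" 1] by simp
qed

lemma mult_smallo_real:
  fixes f g :: "nat \<Rightarrow> real"
  assumes "(\<lambda>n. (f n)\<^sup>2) \<in> o(real)" "(\<lambda>n. (g n)\<^sup>2) \<in> o(real)"
  shows "(\<lambda>n. f n * g n) \<in> o(real)"
proof (rule smallo_real_le)
  show "(\<lambda>n. (f n)\<^sup>2 + (g n)\<^sup>2) \<in> o(real)"
    by (intro sum_in_smallo assms)
qed (rule abs_mult_le_sum_squares)

lemma smallo_real_shift:
  fixes f :: "int \<Rightarrow> real"
  assumes "(\<lambda>k. f (int k)) \<in> o(real)"
  shows "(\<lambda>k. f (int k + a)) \<in> o(real)"
proof (rule landau_o.smallI)
  fix c :: real assume "c > 0"
  then have "eventually (\<lambda>k. \<bar>f (int k)\<bar> \<le> c / 2 * real k) sequentially"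
    using landau_o.smallD[OF assms, of "c / 2"] by simp
  then obtain N where N: "\<And>k. k \<ge> N \<Longrightarrow> \<bar>f (int k)\<bar> \<le> c / 2 * real k"
    by (auto simp: eventually_sequentially)
  show "eventually (\<lambda>k. norm (f (int k + a)) \<le> c * norm (real k)) sequentially"
  proof (rule eventually_sequentiallyI)
    fix k assume k: "k \<ge> N + nat \<bar>a\<bar>"
    define j where "j = nat (int k + a)"
    have j: "int k + a = int j" "j \<ge> N" "j \<le> 2 * k"
      using k by (auto simp: j_def)
    have "\<bar>f (int k + a)\<bar> \<le> c / 2 * real j"
      using N[OF j(2)] j(1) by simp
    also have "\<dots> \<le> c / 2 * real (2 * k)"
      using j(3) \<open>c > 0\<close> by (intro mult_left_mono of_nat_mono) auto
    finally show "norm (f (int k + a)) \<le> c * norm (real k)"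
      by simp
  qed
qed

section \<open>Empirical correlations\<close>

text \<open>
  Sums of products along a trajectory, at arbitrary offsets. With \<open>x\<close> the observed trajectory they
  contain all entries of the normal equations: the Gram matrix of the regressors is
  \<open>corr x x i j n\<close> for \<open>i, j < p\<close>, and the offset \<open>-1\<close> denotes the next observation, so that the
  right-hand side is \<open>corr x x i (-1) n\<close>.
\<close>

definition corr :: "(int \<Rightarrow> real) \<Rightarrow> (int \<Rightarrow> real) \<Rightarrow> int \<Rightarrow> int \<Rightarrow> nat \<Rightarrow> real" where
  "corr x y i j n = (\<Sum>k<n. x (int k - i) * y (int k - j))"

text \<open>
  A shift by one changes the sum by two boundary terms only.
\<close>

lemma sum_shift_smallo:
  fixes f :: "int \<Rightarrow> real"
  assumes f: "(\<lambda>k. f (int k)) \<in> o(real)"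
  shows "(\<lambda>n. (\<Sum>k<n. f (int k + a)) - (\<Sum>k<n. f (int k))) \<in> o(real)"
proof -
  define D where "D a n = (\<Sum>k<n. f (int k + a))" for a n
  have step: "(\<lambda>n. D (a + 1) n - D a n) \<in> o(real)" for a
  proof -
    have "D (a + 1) n - D a n = f (int n + a) - f a" for n
      using sum_lessThan_telescope[of "\<lambda>k. f (int k + a)" n]
      by (simp add: D_def sum_subtractf algebra_simps)
    then show ?thesis
      using sum_in_smallo(2)[OF smallo_real_shift[OF f, of a] const_smallo_real[of "f a"]] by simp
  qed
  have "(\<lambda>n. D a n - D 0 n) \<in> o(real)"
  proof (induction a rule: int_induct[of _ 0])
    case (step1 i)
    show ?case
      using sum_in_smallo(1)[OF step[of i] step1.IH] by simp
  next
    case (step2 i)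
    show ?case
      using sum_in_smallo(2)[OF step2.IH step[of "i - 1"]] by simp
  qed simp
  then show ?thesis
    by (simp add: D_def)
qed

lemma corr_shift_smallo:
  assumes "(\<lambda>k. (x (int k))\<^sup>2) \<in> o(real)" "(\<lambda>k. (y (int k))\<^sup>2) \<in> o(real)"
  shows "(\<lambda>n. corr x y (i + s) (j + s) n - corr x y i j n) \<in> o(real)"
proof -
  have "(\<lambda>k. (x (int k - i))\<^sup>2) \<in> o(real)" "(\<lambda>k. (y (int k - j))\<^sup>2) \<in> o(real)"
    using smallo_real_shift[of "\<lambda>k. (x k)\<^sup>2" "-i"] smallo_real_shift[of "\<lambda>k. (y k)\<^sup>2" "-j"] assms
    by simp_all
  from mult_smallo_real[OF this]
  have "(\<lambda>k. x (int k - i) * y (int k - j)) \<in> o(real)" .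
  from sum_shift_smallo[of "\<lambda>k. x (k - i) * y (k - j)" "-s", OF this]
  show ?thesis
    by (simp add: corr_def algebra_simps)
qed

section \<open>Causal filters\<close>

definition causal_filter :: "(int \<Rightarrow> real) \<Rightarrow> (int \<Rightarrow> real) \<Rightarrow> int \<Rightarrow> real" where
  "causal_filter \<psi> v k = (\<Sum>i\<in>{0..k}. \<psi> (k - i) * v i)"

text \<open>
  The bound over all finite sets of integers is summability of the impulse response in a form that
  applies at once to sums over shifted and reversed index ranges.
\<close>

locale stable_impulse_response =
  fixes \<psi> :: "int \<Rightarrow> real" and B :: real
  assumes causal: "\<And>j. j < 0 \<Longrightarrow> \<psi> j = 0"
    and l1_bound: "\<And>A. finite A \<Longrightarrow> (\<Sum>j\<in>A. \<bar>\<psi> j\<bar>) \<le> B"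
begin

lemma abs_le_bound: "\<bar>\<psi> j\<bar> \<le> B"
  using l1_bound[of "{j}"] by simp

lemma bound_nonneg: "B \<ge> 0"
  using l1_bound[of "{}"] by simp

lemma l1_bound_inj:
  assumes "finite A" "inj_on g A"
  shows "(\<Sum>i\<in>A. \<bar>\<psi> (g i)\<bar>) \<le> B"
  using l1_bound[of "g ` A"] assms by (simp add: sum.reindex)

lemma l2_bound_inj:
  assumes "finite A" "inj_on g A"
  shows "(\<Sum>i\<in>A. (\<psi> (g i))\<^sup>2) \<le> B\<^sup>2"
proof -
  have "(\<Sum>i\<in>A. (\<psi> (g i))\<^sup>2) \<le> (\<Sum>i\<in>A. B * \<bar>\<psi> (g i)\<bar>)"
  proof (rule sum_mono)
    fix i
    have "(\<psi> (g i))\<^sup>2 = \<bar>\<psi> (g i)\<bar> * \<bar>\<psi> (g i)\<bar>"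
      by (simp add: power2_eq_square)
    also have "\<dots> \<le> B * \<bar>\<psi> (g i)\<bar>"
      by (intro mult_right_mono abs_le_bound) simp
    finally show "(\<psi> (g i))\<^sup>2 \<le> B * \<bar>\<psi> (g i)\<bar>" .
  qed
  also have "\<dots> = B * (\<Sum>i\<in>A. \<bar>\<psi> (g i)\<bar>)"
    by (simp add: sum_distrib_left)
  also have "\<dots> \<le> B * B"
    using l1_bound_inj[OF assms] bound_nonneg by (intro mult_left_mono)
  finally show ?thesis
    by (simp add: power2_eq_square)
qed

lemma causal_filter_superset:
  assumes v: "\<And>i. i < 0 \<Longrightarrow> v i = 0" and "finite A" "{0..k} \<subseteq> A"
  shows "causal_filter \<psi> v k = (\<Sum>i\<in>A. \<psi> (k - i) * v i)"
  unfolding causal_filter_def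
proof (rule sum.mono_neutral_left)
  show "\<forall>i\<in>A - {0..k}. \<psi> (k - i) * v i = 0"
  proof
    fix i assume "i \<in> A - {0..k}"
    then have "i < 0 \<or> k - i < 0" by auto
    then show "\<psi> (k - i) * v i = 0"
      using v causal by auto
  qed
qed (use assms in auto)

text \<open>
  By the Cauchy-Schwarz inequality with the weights \<open>\<bar>\<psi>\<bar>\<close>, the square of the filtered value is at
  most \<open>B\<close> times the squares filtered by \<open>\<bar>\<psi>\<bar>\<close>, and the latter are sublinear.
\<close>

lemma causal_filter_square_smallo:
  assumes v: "(\<lambda>k. (v (int k))\<^sup>2) \<in> o(real)"
  shows "(\<lambda>k. (causal_filter \<psi> v (int k))\<^sup>2) \<in> o(real)"
proof (rule smallo_real_le)
  have "(\<Sum>i\<le>n. \<bar>\<bar>\<psi> (int n - int i)\<bar>\<bar>) \<le> B" for n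
    using l1_bound_inj[of "{..n}" "\<lambda>i. int n - int i"] by (simp add: inj_on_def)
  then have "(\<lambda>n. \<Sum>i\<le>n. \<bar>\<psi> (int n - int i)\<bar> * (v (int i))\<^sup>2) \<in> o(real)"
    by (rule sum_weighted_smallo[OF v])
  then show "(\<lambda>n. B * (\<Sum>i\<le>n. \<bar>\<psi> (int n - int i)\<bar> * (v (int i))\<^sup>2)) \<in> o(real)"
    by simp
  fix n
  have "(causal_filter \<psi> v (int n))\<^sup>2 = (\<Sum>i\<le>n. \<psi> (int n - int i) * v (int i))\<^sup>2"
  proof -
    have "{0..int n} = int ` {..n}"
      by (auto simp: image_iff) (metis atMost_iff nat_le_iff int_nat_eq)
    then show ?thesis
      by (simp add: causal_filter_def sum.reindex)
  qed
  also have "\<dots> \<le> (\<Sum>i\<le>n. \<bar>\<psi> (int n - int i)\<bar> * \<bar>v (int i)\<bar>)\<^sup>2"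
    by (subst abs_le_square_iff[symmetric])
      (auto simp: abs_mult intro!: order_trans[OF sum_abs] order_trans[OF _ abs_ge_self])
  also have "\<dots> = (\<Sum>i\<le>n. sqrt \<bar>\<psi> (int n - int i)\<bar> * (sqrt \<bar>\<psi> (int n - int i)\<bar> * \<bar>v (int i)\<bar>))\<^sup>2"
    by (simp flip: mult.assoc)
  also have "\<dots> \<le> (\<Sum>i\<le>n. (sqrt \<bar>\<psi> (int n - int i)\<bar>)\<^sup>2)
      * (\<Sum>i\<le>n. (sqrt \<bar>\<psi> (int n - int i)\<bar> * \<bar>v (int i)\<bar>)\<^sup>2)"
    by (rule Cauchy_Schwarz_ineq_sum)
  also have "\<dots> = (\<Sum>i\<le>n. \<bar>\<psi> (int n - int i)\<bar>) * (\<Sum>i\<le>n. \<bar>\<psi> (int n - int i)\<bar> * (v (int i))\<^sup>2)"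
    by (simp add: power_mult_distrib)
  also have "\<dots> \<le> B * (\<Sum>i\<le>n. \<bar>\<psi> (int n - int i)\<bar> * (v (int i))\<^sup>2)"
    using l1_bound_inj[of "{..n}" "\<lambda>i. int n - int i"]
    by (intro mult_right_mono sum_nonneg) (auto simp: inj_on_def)
  finally show "\<bar>(causal_filter \<psi> v (int n))\<^sup>2\<bar> \<le> B * (\<Sum>i\<le>n. \<bar>\<psi> (int n - int i)\<bar> * (v (int i))\<^sup>2)"
    by simp
qed

text \<open>
  Only the simultaneous noise contributes to the correlation between filter output and noise at
  order \<open>n\<close>: after a shift the sum is over \<open>x\<^sub>m\<^sub>+\<^sub>h v\<^sub>m\<close>, and \<open>x\<^sub>m\<^sub>+\<^sub>h\<close> splits into the contribution of
  the initial value, of the noise before \<open>m\<close>, of \<open>v\<^sub>m\<close> itself with coefficient \<open>\<psi> h\<close>, and of the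
  finitely many later noises up to \<open>m + h\<close>. The initial value is kept apart since it may be
  correlated with the noise; its influence is summable.
\<close>

lemma corr_causal_filter:
  assumes v_neg: "\<And>i. i < 0 \<Longrightarrow> v i = 0"
    and v_sq: "(\<lambda>k. (v (int k))\<^sup>2) \<in> o(real)"
    and past: "\<And>h. (\<lambda>n. \<Sum>m=1..n. (\<Sum>i\<in>{1..<m}. \<psi> (int m + h - int i) * v (int i)) * v (int m)) \<in> o(real)"
    and future: "\<And>l. l \<ge> 1 \<Longrightarrow> (\<lambda>n. \<Sum>m=1..n. v (int (m + l)) * v (int m)) \<in> o(real)"
  shows "(\<lambda>n. corr (causal_filter \<psi> v) v i j n - \<psi> (j - i) * (\<Sum>k<n. (v (int k))\<^sup>2)) \<in> o(real)"
proof -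
  define x where "x = causal_filter \<psi> v"
  define h where "h = j - i"
  \<comment> \<open>For negative \<open>h\<close> there are no later noises, and the coefficients \<open>\<psi> (h - l)\<close> vanish.\<close>
  define H where "H = nat \<bar>h\<bar>"
  define f where "f m = x (int m + h) * v (int m) - \<psi> h * (v (int m))\<^sup>2" for m
  have f_eq: "f m = v 0 * (\<psi> (int m + h) * v (int m))
      + (\<Sum>i\<in>{1..<m}. \<psi> (int m + h - int i) * v (int i)) * v (int m)
      + (\<Sum>l\<in>{1..H}. \<psi> (h - int l) * (v (int (m + l)) * v (int m)))" if "m \<ge> 1" for m
  proof -
    have "x (int m + h) = (\<Sum>i\<in>int ` {..m + H}. \<psi> (int m + h - i) * v i)"
      unfolding x_def
    proof (rule causal_filter_superset[OF v_neg])
      show "{0..int m + h} \<subseteq> int ` {..m + H}"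
      proof
        fix i assume "i \<in> {0..int m + h}"
        then show "i \<in> int ` {..m + H}"
          by (intro image_eqI[of _ _ "nat i"]) (auto simp: H_def)
      qed
    qed auto
    also have "\<dots> = (\<Sum>i\<in>{..m + H}. \<psi> (int m + h - int i) * v (int i))"
      by (simp add: sum.reindex)
    also have "{..m + H} = insert 0 (insert m ({1..<m} \<union> (\<lambda>l. m + l) ` {1..H}))"
    proof (rule Set.set_eqI)
      fix i
      show "i \<in> {..m + H} \<longleftrightarrow> i \<in> insert 0 (insert m ({1..<m} \<union> (\<lambda>l. m + l) ` {1..H}))"
      proof (cases "i \<le> m")
        case False
        then have "i \<in> (\<lambda>l. m + l) ` {1..H} \<longleftrightarrow> i \<le> m + H"
          by (auto intro!: image_eqI[of _ _ "i - m"])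
        with False show ?thesis by auto
      qed (use that in auto)
    qed
    also have "(\<Sum>i\<in>\<dots>. \<psi> (int m + h - int i) * v (int i)) = \<psi> (int m + h) * v 0 + (\<psi> h * v (int m)
        + ((\<Sum>i\<in>{1..<m}. \<psi> (int m + h - int i) * v (int i))
          + (\<Sum>l\<in>{1..H}. \<psi> (h - int l) * v (int (m + l)))))"
    proof -
      have "(\<Sum>i\<in>{1..<m} \<union> (\<lambda>l. m + l) ` {1..H}. \<psi> (int m + h - int i) * v (int i)) =
          (\<Sum>i\<in>{1..<m}. \<psi> (int m + h - int i) * v (int i))
          + (\<Sum>i\<in>(\<lambda>l. m + l) ` {1..H}. \<psi> (int m + h - int i) * v (int i))"
        by (rule sum.union_disjoint) auto
      also have "(\<Sum>i\<in>(\<lambda>l. m + l) ` {1..H}. \<psi> (int m + h - int i) * v (int i)) =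
          (\<Sum>l\<in>{1..H}. \<psi> (h - int l) * v (int (m + l)))"
        by (subst sum.reindex) (auto intro!: sum.cong simp: algebra_simps)
      finally show ?thesis
        using that by (subst sum.insert, simp, force, subst sum.insert) auto
    qed
    finally show ?thesis
      unfolding f_def by (simp add: algebra_simps power2_eq_square sum_distrib_left)
  qed
  have "(\<lambda>n. \<Sum>m\<le>n. \<psi> (int m + h) * v (int m)) \<in> o(real)"
  proof (rule sum_weighted_smallo)
    show "(\<lambda>k. v (int k)) \<in> o(real)"
      by (rule smallo_real_if_square[OF v_sq])
    show "(\<Sum>m\<le>n. \<bar>\<psi> (int m + h)\<bar>) \<le> B" for n
      by (rule l1_bound_inj) (auto simp: inj_on_def)
  qed
  then have first: "(\<lambda>n. v 0 * ((\<Sum>m\<le>n. \<psi> (int m + h) * v (int m)) - \<psi> h * v 0)) \<in> o(real)"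
    by (intro cmult_smallo_real sum_in_smallo const_smallo_real)
  have "(\<lambda>n. \<Sum>m<n. f m) \<in> o(real)"
  proof (rule smallo_real_Suc)
    have "(\<Sum>m<Suc n. f m) = f 0 + v 0 * ((\<Sum>m\<le>n. \<psi> (int m + h) * v (int m)) - \<psi> h * v 0)
        + (\<Sum>m=1..n. (\<Sum>i\<in>{1..<m}. \<psi> (int m + h - int i) * v (int i)) * v (int m))
        + (\<Sum>l\<in>{1..H}. \<psi> (h - int l) * (\<Sum>m=1..n. v (int (m + l)) * v (int m)))" for n
    proof -
      have split: "(\<Sum>m<Suc n. g m) = g 0 + (\<Sum>m=1..n. g m)" for g :: "nat \<Rightarrow> real"
        by (subst sum.lessThan_Suc_shift) (simp add: sum.atLeast1_atMost_eq)
      have "(\<Sum>m\<le>n. \<psi> (int m + h) * v (int m)) - \<psi> h * v 0 = (\<Sum>m=1..n. \<psi> (int m + h) * v (int m))"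
        using split[of "\<lambda>m. \<psi> (int m + h) * v (int m)"] by (simp add: lessThan_Suc_atMost)
      moreover have "(\<Sum>m=1..n. f m) = v 0 * (\<Sum>m=1..n. \<psi> (int m + h) * v (int m))
          + (\<Sum>m=1..n. (\<Sum>i\<in>{1..<m}. \<psi> (int m + h - int i) * v (int i)) * v (int m))
          + (\<Sum>l\<in>{1..H}. \<psi> (h - int l) * (\<Sum>m=1..n. v (int (m + l)) * v (int m)))"
      proof -
        have "(\<Sum>m=1..n. f m) = (\<Sum>m=1..n. v 0 * (\<psi> (int m + h) * v (int m))
            + (\<Sum>i\<in>{1..<m}. \<psi> (int m + h - int i) * v (int i)) * v (int m)
            + (\<Sum>l\<in>{1..H}. \<psi> (h - int l) * (v (int (m + l)) * v (int m))))"
          by (intro sum.cong refl f_eq) simp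
        moreover have "(\<Sum>m=1..n. \<Sum>l\<in>{1..H}. \<psi> (h - int l) * (v (int (m + l)) * v (int m)))
            = (\<Sum>l\<in>{1..H}. \<psi> (h - int l) * (\<Sum>m=1..n. v (int (m + l)) * v (int m)))"
          unfolding sum_distrib_left by (rule sum.swap)
        ultimately show ?thesis
          by (simp only: sum.distrib sum_distrib_left)
      qed
      ultimately show ?thesis
        by (simp only: split[of f] add.assoc)
    qed
    moreover have "(\<lambda>n. f 0 + v 0 * ((\<Sum>m\<le>n. \<psi> (int m + h) * v (int m)) - \<psi> h * v 0)
        + (\<Sum>m=1..n. (\<Sum>i\<in>{1..<m}. \<psi> (int m + h - int i) * v (int i)) * v (int m))
        + (\<Sum>l\<in>{1..H}. \<psi> (h - int l) * (\<Sum>m=1..n. v (int (m + l)) * v (int m)))) \<in> o(real)"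
    proof (intro sum_in_smallo(1) first past const_smallo_real big_sum_in_smallo)
      fix l assume "l \<in> {1..H}"
      then have "(\<lambda>n. \<Sum>m=1..n. v (int (m + l)) * v (int m)) \<in> o(real)"
        by (intro future) auto
      then show "(\<lambda>n. \<psi> (h - int l) * (\<Sum>m=1..n. v (int (m + l)) * v (int m))) \<in> o(real)"
        by (rule cmult_smallo_real)
    qed
    ultimately show "(\<lambda>n. \<Sum>m<Suc n. f m) \<in> o(real)"
      by simp
  qed
  moreover have "(\<lambda>n. corr x v (- h + j) (0 + j) n - corr x v (- h) 0 n) \<in> o(real)"
    unfolding x_def by (rule corr_shift_smallo[OF causal_filter_square_smallo[OF v_sq] v_sq])
  ultimately have "(\<lambda>n. (corr x v (- h + j) (0 + j) n - corr x v (- h) 0 n) + (\<Sum>m<n. f m)) \<in> o(real)"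
    by (intro sum_in_smallo(1))
  moreover have "(\<Sum>m<n. f m) = corr x v (- h) 0 n - \<psi> h * (\<Sum>k<n. (v (int k))\<^sup>2)" for n
    by (simp add: f_def corr_def sum_subtractf sum_distrib_left)
  ultimately show ?thesis
    by (simp add: h_def x_def)
qed

end

context white_noise
begin

lemma AE_corr_causal_filter:
  fixes v :: "int \<Rightarrow> 'a \<Rightarrow> real"
  assumes "stable_impulse_response \<psi> B"
    and v_neg: "\<And>k \<omega>. k < 0 \<Longrightarrow> v k \<omega> = 0" and v_pos: "\<And>k. k \<ge> 1 \<Longrightarrow> v (int k) = V k"
    and v_sq: "AE \<omega> in M. (\<lambda>k. (V k \<omega>)\<^sup>2) \<in> o(real)"
  shows "AE \<omega> in M. \<forall>i j. (\<lambda>n. corr (causal_filter \<psi> (\<lambda>k. v k \<omega>)) (\<lambda>k. v k \<omega>) i j n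
            - \<psi> (j - i) * (\<Sum>k<n. (v (int k) \<omega>)\<^sup>2)) \<in> o(real)"
proof -
  interpret stable_impulse_response \<psi> B by fact
  have "AE \<omega> in M. (\<lambda>n. \<Sum>m=1..n. (\<Sum>i\<in>{1..<m}. \<psi> (int m + h - int i) * V i \<omega>) * V m \<omega>) \<in> o(real)" for h
    by (rule AE_predictable_sum_smallo[where B = "B\<^sup>2"], rule l2_bound_inj) (auto simp: inj_on_def)
  then have past: "AE \<omega> in M. \<forall>h. (\<lambda>n. \<Sum>m=1..n. (\<Sum>i\<in>{1..<m}. \<psi> (int m + h - int i) * V i \<omega>) * V m \<omega>) \<in> o(real)"
    by (simp add: AE_all_countable)
  \<comment> \<open>Lagged products of the noise, written as predictable sums with unit weights at lag \<open>l\<close>.\<close>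
  have "AE \<omega> in M. (\<lambda>n. \<Sum>k=1..n. (\<Sum>i\<in>{1..<k}. of_bool (i + l = k) * V i \<omega>) * V k \<omega>) \<in> o(real)" for l
  proof (rule AE_predictable_sum_smallo[where B = 1])
    fix k
    have "(\<Sum>i\<in>{1..<k}. (of_bool (i + l = k) :: real)\<^sup>2) \<le> (\<Sum>i\<in>{1..<k}. if i = k - l then 1 else 0)"
      by (intro sum_mono) auto
    also have "\<dots> \<le> 1"
      by simp
    finally show "(\<Sum>i\<in>{1..<k}. (of_bool (i + l = k) :: real)\<^sup>2) \<le> 1" .
  qed
  then have future: "AE \<omega> in M. \<forall>l. (\<lambda>n. \<Sum>k=1..n. (\<Sum>i\<in>{1..<k}. of_bool (i + l = k) * V i \<omega>) * V k \<omega>) \<in> o(real)"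
    by (simp add: AE_all_countable)
  from past future v_sq show ?thesis
  proof eventually_elim
    case (elim \<omega>)
    have "(\<lambda>n. corr (causal_filter \<psi> (\<lambda>k. v k \<omega>)) (\<lambda>k. v k \<omega>) i j n
            - \<psi> (j - i) * (\<Sum>k<n. (v (int k) \<omega>)\<^sup>2)) \<in> o(real)" for i j
    proof (rule corr_causal_filter)
      show "(\<lambda>k. (v (int k) \<omega>)\<^sup>2) \<in> o(real)"
      proof (rule landau_o.small.in_cong[THEN iffD2])
        show "(\<lambda>k. (V k \<omega>)\<^sup>2) \<in> o(real)" by (rule elim(3))
        show "eventually (\<lambda>k. (v (int k) \<omega>)\<^sup>2 = (V k \<omega>)\<^sup>2) sequentially"
          by (rule eventually_sequentiallyI[of 1]) (simp add: v_pos)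
      qed
    next
      fix h
      have "(\<Sum>m=1..n. (\<Sum>i\<in>{1..<m}. \<psi> (int m + h - int i) * v (int i) \<omega>) * v (int m) \<omega>) =
          (\<Sum>m=1..n. (\<Sum>i\<in>{1..<m}. \<psi> (int m + h - int i) * V i \<omega>) * V m \<omega>)" for n
        by (intro sum.cong arg_cong2[where f = "(*)"]) (auto simp: v_pos)
      then show "(\<lambda>n. \<Sum>m=1..n. (\<Sum>i\<in>{1..<m}. \<psi> (int m + h - int i) * v (int i) \<omega>) * v (int m) \<omega>) \<in> o(real)"
        using elim(1) by simp
    next
      fix l :: nat assume "l \<ge> 1"
      define F where "F n = (\<Sum>k=1..n. (\<Sum>i\<in>{1..<k}. of_bool (i + l = k) * V i \<omega>) * V k \<omega>)" for n
      have F_eq: "F (n + l) = (\<Sum>m=1..n. v (int (m + l)) \<omega> * v (int m) \<omega>)" for n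
      proof -
        have "F (n + l) = (\<Sum>k\<in>(\<lambda>m. m + l) ` {1..n}. (\<Sum>i\<in>{1..<k}. of_bool (i + l = k) * V i \<omega>) * V k \<omega>)"
          unfolding F_def
        proof (rule sum.mono_neutral_right)
          show "\<forall>k\<in>{1..n + l} - (\<lambda>m. m + l) ` {1..n}. (\<Sum>i\<in>{1..<k}. of_bool (i + l = k) * V i \<omega>) * V k \<omega> = 0"
            by (force simp: image_iff intro!: sum.neutral)
        qed auto
        also have "\<dots> = (\<Sum>m=1..n. (\<Sum>i\<in>{1..<m + l}. of_bool (i + l = m + l) * V i \<omega>) * V (m + l) \<omega>)"
          by (subst sum.reindex) auto
        also have "\<dots> = (\<Sum>m=1..n. V m \<omega> * V (m + l) \<omega>)"
        proof (rule sum.cong)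
          fix m assume m: "m \<in> {1..n}"
          have "(\<Sum>i\<in>{1..<m + l}. of_bool (i + l = m + l) * V i \<omega>) = (\<Sum>i\<in>{1..<m + l}. if i = m then V i \<omega> else 0)"
            by (intro sum.cong) auto
          then show "(\<Sum>i\<in>{1..<m + l}. of_bool (i + l = m + l) * V i \<omega>) * V (m + l) \<omega> = V m \<omega> * V (m + l) \<omega>"
            using m \<open>l \<ge> 1\<close> by simp
        qed simp
        also have "\<dots> = (\<Sum>m=1..n. v (int (m + l)) \<omega> * v (int m) \<omega>)"
          using v_pos by (intro sum.cong) (auto simp: mult.commute simp del: of_nat_add)
        finally show ?thesis .
      qed
      have "F \<in> o(real)"
        unfolding F_def using elim(2) by blast
      then have "(\<lambda>n. F (n + l)) \<in> o(real)"
        using smallo_real_shift[of "\<lambda>k. F (nat k)" "int l"] by (simp add: nat_add_distrib)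
      then show "(\<lambda>n. \<Sum>m=1..n. v (int (m + l)) \<omega> * v (int m) \<omega>) \<in> o(real)"
        unfolding F_eq .
    qed (use v_neg in auto)
    then show ?case by blast
  qed
qed

end

section \<open>Excitation of the regressors\<close>

text \<open>
  The map from \<open>u\<close> to \<open>w\<close> is lower triangular with unit diagonal; forward substitution bounds its
  inverse.
\<close>

lemma triangular_l1_bound:
  fixes u :: "nat \<Rightarrow> real" and \<psi> :: "int \<Rightarrow> real" and p :: nat
  assumes lead: "\<psi> 0 = 1" and causal: "\<And>j. j < 0 \<Longrightarrow> \<psi> j = 0" and bound: "\<And>j. \<bar>\<psi> j\<bar> \<le> B"
  defines "w \<equiv> \<lambda>j. \<Sum>i<p. u i * \<psi> (int j - int i)"
  shows "(\<Sum>j<p. \<bar>u j\<bar>) \<le> real p * (1 + B) ^ p * (\<Sum>j<p. \<bar>w j\<bar>)"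
proof -
  define W where "W = (\<Sum>j<p. \<bar>w j\<bar>)"
  have "W \<ge> 0" by (simp add: W_def sum_nonneg)
  have "B \<ge> 0" using bound[of 0] by linarith
  have u_le: "\<bar>u j\<bar> \<le> (1 + B) ^ j * W" if "j < p" for j
    using that
  proof (induction j rule: less_induct)
    case (less j)
    have "w j = (\<Sum>i\<in>insert j {..<j}. u i * \<psi> (int j - int i))"
      unfolding w_def using less.prems by (intro sum.mono_neutral_right) (auto simp: causal)
    then have w_j: "w j = u j + (\<Sum>i<j. u i * \<psi> (int j - int i))"
      by (simp add: lead)
    have "\<bar>\<Sum>i<j. u i * \<psi> (int j - int i)\<bar> \<le> (\<Sum>i<j. (1 + B) ^ i * W * B)"
    proof (rule order_trans[OF sum_abs sum_mono])
      fix i assume "i \<in> {..<j}"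
      then have "\<bar>u i\<bar> \<le> (1 + B) ^ i * W"
        using less by auto
      then show "\<bar>u i * \<psi> (int j - int i)\<bar> \<le> (1 + B) ^ i * W * B"
        unfolding abs_mult using bound \<open>W \<ge> 0\<close> \<open>B \<ge> 0\<close> by (intro mult_mono) auto
    qed
    also have "\<dots> = ((1 + B) ^ j - 1) * W"
      using power_diff_1_eq[of "1 + B" j] by (simp add: sum_distrib_left sum_distrib_right mult_ac)
    finally have "\<bar>\<Sum>i<j. u i * \<psi> (int j - int i)\<bar> \<le> ((1 + B) ^ j - 1) * W" .
    moreover have "\<bar>w j\<bar> \<le> W"
      unfolding W_def using less.prems by (intro member_le_sum[where f = "\<lambda>j. \<bar>w j\<bar>"]) auto
    ultimately show ?case
      using w_j by (simp add: algebra_simps)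
  qed
  have "(\<Sum>j<p. \<bar>u j\<bar>) \<le> (\<Sum>j<p. (1 + B) ^ p * W)"
  proof (rule sum_mono)
    fix j assume "j \<in> {..<p}"
    then have "\<bar>u j\<bar> \<le> (1 + B) ^ j * W"
      using u_le by simp
    also have "\<dots> \<le> (1 + B) ^ p * W"
      using \<open>j \<in> {..<p}\<close> \<open>B \<ge> 0\<close> \<open>W \<ge> 0\<close> by (intro mult_right_mono power_increasing) auto
    finally show "\<bar>u j\<bar> \<le> (1 + B) ^ p * W" .
  qed
  then show ?thesis
    by (simp add: W_def mult.assoc)
qed

lemma sum_mult_linear_combinations:
  fixes x y :: "int \<Rightarrow> real" and u w :: "nat \<Rightarrow> real"
  shows "(\<Sum>k<n. (\<Sum>i<p. u i * x (int k - int i)) * (\<Sum>j<q. w j * y (int k - int j))) =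
    (\<Sum>i<p. \<Sum>j<q. u i * w j * corr x y (int i) (int j) n)"
proof -
  have "(\<Sum>k<n. (\<Sum>i<p. u i * x (int k - int i)) * (\<Sum>j<q. w j * y (int k - int j))) =
      (\<Sum>k<n. \<Sum>i<p. \<Sum>j<q. u i * w j * (x (int k - int i) * y (int k - int j)))"
    by (simp add: sum_product mult_ac)
  also have "\<dots> = (\<Sum>i<p. \<Sum>j<q. \<Sum>k<n. u i * w j * (x (int k - int i) * y (int k - int j)))"
    by (subst sum.swap, rule sum.cong[OF refl], rule sum.swap)
  finally show ?thesis
    by (simp add: corr_def sum_distrib_left)
qed

text \<open>
  The smallest eigenvalue of the Gram matrix of the regressors grows at least linearly. A linear
  combination \<open>X\<^sub>k\<close> of the regressor entries satisfies \<open>X\<^sub>k\<^sup>2 \<ge> 2 X\<^sub>k T\<^sub>k - T\<^sub>k\<^sup>2\<close> for every test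
  sequence \<open>T\<close>. With \<open>x\<close> thought of as \<open>v\<close> filtered by \<open>\<psi>\<close>, take for \<open>T\<^sub>k\<close> the part of \<open>X\<^sub>k\<close> that is due to the noises at the times
  \<open>k, \<dots>, k - p + 1\<close>, whose coefficients are \<open>w\<close>. Then both sums on the right are \<open>\<bar>w\<bar>\<^sup>2 N n\<close> up to an error
  that is \<open>\<bar>u\<bar>\<^sup>2 o(n)\<close> uniformly in \<open>u\<close>, and \<open>w\<close> controls \<open>u\<close>. Here \<open>N\<close> stands for the energy of the
  noise.
\<close>

lemma persistent_excitation:
  fixes x v \<psi> :: "int \<Rightarrow> real" and N :: "nat \<Rightarrow> real"
  assumes lead: "\<psi> 0 = 1" and causal: "\<And>j. j < 0 \<Longrightarrow> \<psi> j = 0" and bound: "\<And>j. \<bar>\<psi> j\<bar> \<le> B"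
    and cross: "\<And>i j. (\<lambda>n. corr x v i j n - \<psi> (j - i) * N n) \<in> o(real)"
    and white: "\<And>i j. (\<lambda>n. corr v v i j n - of_bool (i = j) * N n) \<in> o(real)"
    and c: "c > 0" "eventually (\<lambda>n. c * real n \<le> N n) sequentially"
    and p: "p \<ge> 1"
  shows "\<exists>\<kappa>>0. eventually (\<lambda>n. \<forall>u. \<kappa> * real n * (\<Sum>i<p. \<bar>u i\<bar>)\<^sup>2
    \<le> (\<Sum>k<n. (\<Sum>i<p. u i * x (int k - int i))\<^sup>2)) sequentially"
proof -
  define E where "E i j n = corr x v (int i) (int j) n - \<psi> (int j - int i) * N n" for i j n
  define F where "F i j n = corr v v (int i) (int j) n - of_bool (i = j) * N n" for i j n
  define \<eta> where "\<eta> n = (\<Sum>i<p. \<Sum>j<p. \<bar>E i j n\<bar> + \<bar>F i j n\<bar>)" for n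
  have E_small: "(\<lambda>n. E i j n) \<in> o(real)" for i j
    unfolding E_def by (rule cross)
  have F_small: "(\<lambda>n. F i j n) \<in> o(real)" for i j
    using white[of "int i" "int j"] by (simp add: F_def)
  have \<eta>_small: "\<eta> \<in> o(real)"
    unfolding \<eta>_def by (intro big_sum_in_smallo sum_in_smallo) (simp_all add: E_small F_small)
  have "B \<ge> 0" using bound[of 0] by linarith
  define K where "K = real p * (1 + B) ^ p"
  have "K > 0" using p \<open>B \<ge> 0\<close> by (simp add: K_def)
  \<comment> \<open>Half of the energy bound \<open>c / (p K\<^sup>2)\<close>; the other half absorbs the error terms.\<close>
  define \<kappa> where "\<kappa> = c / (2 * real p * K\<^sup>2)"
  have "\<kappa> > 0" using c p \<open>K > 0\<close> by (simp add: \<kappa>_def)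
  define C where "C = 2 * B + B\<^sup>2 + 1"
  have "C > 0" using \<open>B \<ge> 0\<close> by (simp add: C_def add_nonneg_pos)
  have "eventually (\<lambda>n. \<bar>\<eta> n\<bar> \<le> \<kappa> / C * real n) sequentially"
    using landau_o.smallD[OF \<eta>_small, of "\<kappa> / C"] \<open>\<kappa> > 0\<close> \<open>C > 0\<close> by simp
  then have "eventually (\<lambda>n. \<forall>u. \<kappa> * real n * (\<Sum>i<p. \<bar>u i\<bar>)\<^sup>2
    \<le> (\<Sum>k<n. (\<Sum>i<p. u i * x (int k - int i))\<^sup>2)) sequentially"
    using c(2)
  proof eventually_elim
    case (elim n)
    show ?case
    proof
      fix u :: "nat \<Rightarrow> real"
      define w where "w j = (\<Sum>i<p. u i * \<psi> (int j - int i))" for j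
      define s where "s = (\<Sum>i<p. \<bar>u i\<bar>)"
      have "s \<ge> 0" by (simp add: s_def sum_nonneg)
      have w_le: "\<bar>w j\<bar> \<le> B * s" for j
      proof -
        have "\<bar>w j\<bar> \<le> (\<Sum>i<p. \<bar>u i\<bar> * B)"
          unfolding w_def using bound
          by (intro order_trans[OF sum_abs] sum_mono) (auto simp: abs_mult intro!: mult_left_mono)
        then show ?thesis
          by (simp add: s_def sum_distrib_left mult.commute)
      qed
      have u_le: "\<bar>u i\<bar> \<le> s" if "i < p" for i
        unfolding s_def using that by (intro member_le_sum[where f = "\<lambda>i. \<bar>u i\<bar>"]) auto
      define X where "X k = (\<Sum>i<p. u i * x (int k - int i))" for k
      define T where "T k = (\<Sum>j<p. w j * v (int k - int j))" for k
      have "(\<Sum>k<n. X k * T k) = (\<Sum>i<p. \<Sum>j<p. u i * w j * (\<psi> (int j - int i) * N n + E i j n))"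
        unfolding X_def T_def sum_mult_linear_combinations by (simp add: E_def)
      also have "\<dots> = (\<Sum>i<p. \<Sum>j<p. u i * w j * \<psi> (int j - int i) * N n)
          + (\<Sum>i<p. \<Sum>j<p. u i * w j * E i j n)"
        by (simp add: distrib_left sum.distrib mult.assoc)
      also have "(\<Sum>i<p. \<Sum>j<p. u i * w j * \<psi> (int j - int i) * N n) = (\<Sum>j<p. (w j)\<^sup>2) * N n"
        by (subst sum.swap)
          (simp add: w_def power2_eq_square sum_distrib_left sum_distrib_right mult_ac)
      finally have XT: "(\<Sum>k<n. X k * T k) = (\<Sum>j<p. (w j)\<^sup>2) * N n + (\<Sum>i<p. \<Sum>j<p. u i * w j * E i j n)" .
      have "(\<Sum>k<n. T k * T k) = (\<Sum>i<p. \<Sum>j<p. w i * w j * (of_bool (i = j) * N n + F i j n))"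
        unfolding T_def sum_mult_linear_combinations by (simp add: F_def)
      also have "\<dots> = (\<Sum>i<p. \<Sum>j<p. if i = j then (w i)\<^sup>2 * N n else 0) + (\<Sum>i<p. \<Sum>j<p. w i * w j * F i j n)"
        unfolding distrib_left sum.distrib
        by (intro arg_cong2[where f = "(+)"] sum.cong) (auto simp: power2_eq_square)
      finally have TT: "(\<Sum>k<n. T k * T k) = (\<Sum>j<p. (w j)\<^sup>2) * N n + (\<Sum>i<p. \<Sum>j<p. w i * w j * F i j n)"
        by (simp add: sum_distrib_right)
      have "\<bar>2 * (\<Sum>i<p. \<Sum>j<p. u i * w j * E i j n) - (\<Sum>i<p. \<Sum>j<p. w i * w j * F i j n)\<bar>
          = \<bar>\<Sum>i<p. \<Sum>j<p. 2 * (u i * w j * E i j n) - w i * w j * F i j n\<bar>"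
        by (simp add: sum_subtractf sum_distrib_left)
      also have "\<dots> \<le> (\<Sum>i<p. \<Sum>j<p. C * s\<^sup>2 * (\<bar>E i j n\<bar> + \<bar>F i j n\<bar>))"
      proof (intro order_trans[OF sum_abs] sum_mono)
        fix i j assume i: "i \<in> {..<p}" and j: "j \<in> {..<p}"
        have "\<bar>u i\<bar> * \<bar>w j\<bar> \<le> s * (B * s)"
          using u_le i w_le \<open>s \<ge> 0\<close> by (intro mult_mono) auto
        moreover have "\<bar>w i\<bar> * \<bar>w j\<bar> \<le> (B * s) * (B * s)"
          using w_le \<open>s \<ge> 0\<close> \<open>B \<ge> 0\<close> by (intro mult_mono) auto
        moreover have "2 * B * s\<^sup>2 \<le> C * s\<^sup>2" "B\<^sup>2 * s\<^sup>2 \<le> C * s\<^sup>2"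
          using \<open>B \<ge> 0\<close> by (auto intro!: mult_right_mono simp: C_def)
        ultimately have "2 * (\<bar>u i\<bar> * \<bar>w j\<bar>) \<le> C * s\<^sup>2" "\<bar>w i\<bar> * \<bar>w j\<bar> \<le> C * s\<^sup>2"
          by (auto simp: power2_eq_square mult_ac)
        then have "2 * (\<bar>u i\<bar> * \<bar>w j\<bar>) * \<bar>E i j n\<bar> \<le> C * s\<^sup>2 * \<bar>E i j n\<bar>"
          "\<bar>w i\<bar> * \<bar>w j\<bar> * \<bar>F i j n\<bar> \<le> C * s\<^sup>2 * \<bar>F i j n\<bar>"
          by (auto intro!: mult_right_mono)
        then have "\<bar>2 * (u i * w j * E i j n)\<bar> + \<bar>w i * w j * F i j n\<bar> \<le> C * s\<^sup>2 * (\<bar>E i j n\<bar> + \<bar>F i j n\<bar>)"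
          by (simp add: abs_mult mult.assoc distrib_left)
        then show "\<bar>2 * (u i * w j * E i j n) - w i * w j * F i j n\<bar> \<le> C * s\<^sup>2 * (\<bar>E i j n\<bar> + \<bar>F i j n\<bar>)"
          by linarith
      qed
      also have "\<dots> = C * s\<^sup>2 * \<eta> n"
        by (simp add: \<eta>_def sum_distrib_left)
      also have "\<dots> \<le> C * s\<^sup>2 * (\<kappa> / C * real n)"
        using elim(1) \<open>C > 0\<close> by (intro mult_left_mono) auto
      also have "\<dots> = \<kappa> * real n * s\<^sup>2"
        using \<open>C > 0\<close> by simp
      finally have err: "\<bar>2 * (\<Sum>i<p. \<Sum>j<p. u i * w j * E i j n) - (\<Sum>i<p. \<Sum>j<p. w i * w j * F i j n)\<bar>
          \<le> \<kappa> * real n * s\<^sup>2" .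
      have "s \<le> K * (\<Sum>j<p. \<bar>w j\<bar>)"
        unfolding s_def K_def w_def using triangular_l1_bound[of \<psi> B, OF lead causal bound] by blast
      then have "s\<^sup>2 \<le> (K * (\<Sum>j<p. \<bar>w j\<bar>))\<^sup>2"
        using \<open>s \<ge> 0\<close> by (intro power_mono)
      also have "\<dots> = K\<^sup>2 * (\<Sum>j<p. \<bar>w j\<bar> * 1)\<^sup>2"
        by (simp add: power_mult_distrib)
      also have "\<dots> \<le> K\<^sup>2 * ((\<Sum>j<p. \<bar>w j\<bar>\<^sup>2) * (\<Sum>j<p. 1\<^sup>2))"
        by (intro mult_left_mono Cauchy_Schwarz_ineq_sum) auto
      finally have s_le: "s\<^sup>2 \<le> real p * K\<^sup>2 * (\<Sum>j<p. (w j)\<^sup>2)"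
        by (simp add: mult_ac)
      have "2 * \<kappa> * real n * s\<^sup>2 \<le> 2 * \<kappa> * real n * (real p * K\<^sup>2 * (\<Sum>j<p. (w j)\<^sup>2))"
        using s_le \<open>\<kappa> > 0\<close> by (intro mult_left_mono) auto
      also have "\<dots> = (\<Sum>j<p. (w j)\<^sup>2) * (c * real n)"
        using p \<open>K > 0\<close> by (simp add: \<kappa>_def field_simps)
      also have "\<dots> \<le> (\<Sum>j<p. (w j)\<^sup>2) * N n"
        using elim(2) by (intro mult_left_mono sum_nonneg) auto
      finally have main: "2 * \<kappa> * real n * s\<^sup>2 \<le> (\<Sum>j<p. (w j)\<^sup>2) * N n" .
      have "(\<Sum>k<n. 2 * (X k * T k) - T k * T k) \<le> (\<Sum>k<n. (X k)\<^sup>2)"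
      proof (rule sum_mono)
        fix k
        show "2 * (X k * T k) - T k * T k \<le> (X k)\<^sup>2"
          using zero_le_power2[of "X k - T k"] by (simp add: power2_eq_square algebra_simps)
      qed
      then have "2 * (\<Sum>k<n. X k * T k) - (\<Sum>k<n. T k * T k) \<le> (\<Sum>k<n. (X k)\<^sup>2)"
        by (simp add: sum_subtractf sum_distrib_left)
      then have "\<kappa> * real n * s\<^sup>2 \<le> (\<Sum>k<n. (X k)\<^sup>2)"
        using XT TT err main by linarith
      then show "\<kappa> * real n * (\<Sum>i<p. \<bar>u i\<bar>)\<^sup>2 \<le> (\<Sum>k<n. (\<Sum>i<p. u i * x (int k - int i))\<^sup>2)"
        by (simp add: s_def X_def)
    qed
  qed
  then show ?thesis
    using \<open>\<kappa> > 0\<close> by (intro exI[of _ \<kappa>] conjI)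
qed

section \<open>The impulse response of the process\<close>

lemma l1_norm_fps_mult:
  fixes F G :: "real fps"
  shows "(\<Sum>n<N. \<bar>fps_nth (F * G) n\<bar>) \<le> (\<Sum>n<N. \<bar>fps_nth F n\<bar>) * (\<Sum>n<N. \<bar>fps_nth G n\<bar>)"
proof -
  have "(\<Sum>n<N. \<bar>fps_nth (F * G) n\<bar>) \<le> (\<Sum>n<N. \<Sum>i\<le>n. \<bar>fps_nth F i\<bar> * \<bar>fps_nth G (n - i)\<bar>)"
    unfolding fps_mult_nth atLeast0AtMost
    by (intro sum_mono order_trans[OF sum_abs]) (simp add: abs_mult)
  also have "\<dots> = (\<Sum>(i, j)\<in>{(i, j). i + j < N}. \<bar>fps_nth F i\<bar> * \<bar>fps_nth G j\<bar>)"
    by (rule sum.triangle_reindex[symmetric])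
  also have "\<dots> \<le> (\<Sum>(i, j)\<in>{..<N} \<times> {..<N}. \<bar>fps_nth F i\<bar> * \<bar>fps_nth G j\<bar>)"
    by (intro sum_mono2) auto
  also have "\<dots> = (\<Sum>n<N. \<bar>fps_nth F n\<bar>) * (\<Sum>n<N. \<bar>fps_nth G n\<bar>)"
    by (simp add: sum_product sum.cartesian_product)
  finally show ?thesis .
qed

text \<open>
  The autoregressive polynomial \<open>1 - a\<^sub>1 z - \<dots> - a\<^sub>p z\<^sup>p\<close>, with \<open>a\<^sub>i\<close> stored at index \<open>i - 1\<close>.
\<close>

definition ar_fps :: "nat \<Rightarrow> (nat \<Rightarrow> real) \<Rightarrow> real fps" where
  "ar_fps p a = Abs_fps (\<lambda>n. if n = 0 then 1 else if n \<le> p then - a (n - 1) else 0)"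

lemma ar_fps_nth_0: "fps_nth (ar_fps p a) 0 = 1"
  by (simp add: ar_fps_def)

lemma ar_fps_mult:
  fixes y :: "int \<Rightarrow> real"
  assumes neg: "\<And>k. k < 0 \<Longrightarrow> y k = 0"
    and rec: "\<And>n. y (int n) = (\<Sum>i<p. a i * y (int n - 1 - int i)) + e n"
  shows "ar_fps p a * Abs_fps (\<lambda>n. y (int n)) = Abs_fps e"
proof (rule fps_ext)
  fix n
  define g where "g i = fps_nth (ar_fps p a) i * y (int n - int i)" for i
  have "fps_nth (ar_fps p a * Abs_fps (\<lambda>n. y (int n))) n = (\<Sum>i=0..n. g i)"
    unfolding fps_mult_nth g_def by (intro sum.cong) (auto simp: of_nat_diff)
  also have "\<dots> = (\<Sum>i\<le>n + p. g i)"
    by (intro sum.mono_neutral_left) (auto simp: g_def neg)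
  also have "\<dots> = (\<Sum>i<Suc p. g i)"
    by (intro sum.mono_neutral_right) (auto simp: g_def ar_fps_def)
  also have "\<dots> = g 0 + (\<Sum>i<p. g (Suc i))"
    by (rule sum.lessThan_Suc_shift)
  also have "(\<Sum>i<p. g (Suc i)) = - (\<Sum>i<p. a i * y (int n - 1 - int i))"
    unfolding sum_negf[symmetric] by (intro sum.cong) (auto simp: g_def ar_fps_def algebra_simps)
  also have "g 0 = y (int n)"
    by (simp add: g_def ar_fps_def)
  finally show "fps_nth (ar_fps p a * Abs_fps (\<lambda>n. y (int n))) n = fps_nth (Abs_fps e) n"
    using rec[of n] by simp
qed

text \<open>
  The inverse \<open>F\<close> solves \<open>F = 1 + G F\<close> where \<open>G\<close> has \<open>l\<^sup>1\<close> norm \<open>\<Sum>\<bar>a i\<bar> < 1\<close>; truncated \<open>l\<^sup>1\<close> norms are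
  submultiplicative, which gives the geometric series bound.
\<close>

lemma l1_norm_inverse_ar_fps:
  assumes stable: "(\<Sum>i<p. \<bar>a i\<bar>) < 1"
  shows "(\<Sum>n<N. \<bar>fps_nth (inverse (ar_fps p a)) n\<bar>) \<le> 1 / (1 - (\<Sum>i<p. \<bar>a i\<bar>))"
proof -
  define F where "F = inverse (ar_fps p a)"
  define G where "G = 1 - ar_fps p a"
  define L where "L H = (\<Sum>n<N. \<bar>fps_nth H n\<bar>)" for H :: "real fps"
  have "ar_fps p a * F = 1"
    unfolding F_def using ar_fps_nth_0[of p a] inverse_mult_eq_1[of "ar_fps p a"]
    by (simp add: mult.commute)
  then have F_eq: "F = 1 + G * F"
    by (simp add: G_def algebra_simps)
  have "L G \<le> (\<Sum>i<p. \<bar>a i\<bar>)"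
  proof -
    have "L G \<le> (\<Sum>n<Suc (N + p). \<bar>fps_nth G n\<bar>)"
      unfolding L_def by (intro sum_mono2) auto
    also have "\<dots> = (\<Sum>n<N + p. \<bar>fps_nth G (Suc n)\<bar>)"
      by (subst sum.lessThan_Suc_shift) (simp add: G_def ar_fps_def)
    also have "\<dots> = (\<Sum>n<p. \<bar>fps_nth G (Suc n)\<bar>)"
      by (intro sum.mono_neutral_right) (auto simp: G_def ar_fps_def)
    also have "\<dots> = (\<Sum>i<p. \<bar>a i\<bar>)"
      by (intro sum.cong) (auto simp: G_def ar_fps_def)
    finally show ?thesis .
  qed
  have "fps_nth F n = fps_nth 1 n + fps_nth (G * F) n" for n
    using arg_cong[OF F_eq, of "\<lambda>H. fps_nth H n"] by (simp only: fps_add_nth)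
  then have "L F \<le> L 1 + L (G * F)"
    unfolding L_def sum.distrib[symmetric] by (intro sum_mono) (simp only: abs_triangle_ineq)
  also have "L (1 :: real fps) \<le> 1"
  proof -
    have "L 1 = (\<Sum>n<N. if n = 0 then 1 else 0)"
      unfolding L_def by (intro sum.cong) auto
    then show ?thesis by simp
  qed
  also have "L (G * F) \<le> L G * L F"
    unfolding L_def by (rule l1_norm_fps_mult)
  also have "L G * L F \<le> (\<Sum>i<p. \<bar>a i\<bar>) * L F"
    using \<open>L G \<le> _\<close> by (intro mult_right_mono) (auto simp: L_def sum_nonneg)
  finally have "L F * (1 - (\<Sum>i<p. \<bar>a i\<bar>)) \<le> 1"
    by (simp add: algebra_simps)
  then show ?thesis
    using stable by (simp add: L_def F_def field_simps)
qed

text \<open>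
  The process is obtained from the noise by two autoregressions in a row, of orders \<open>1\<close> and \<open>p\<close>.
\<close>

definition impulse_response :: "nat \<Rightarrow> (nat \<Rightarrow> real) \<Rightarrow> real \<Rightarrow> int \<Rightarrow> real" where
  "impulse_response p a \<rho> k =
     (if k < 0 then 0 else fps_nth (inverse (ar_fps p a) * inverse (ar_fps 1 (\<lambda>_. \<rho>))) (nat k))"

lemma impulse_response_0: "impulse_response p a \<rho> 0 = 1"
  by (simp add: impulse_response_def ar_fps_nth_0 fps_inverse_nth_0)

lemma stable_impulse_response_ar:
  assumes "(\<Sum>i<p. \<bar>a i\<bar>) < 1" "\<bar>\<rho>\<bar> < 1"
  shows "stable_impulse_response (impulse_response p a \<rho>) (1 / (1 - (\<Sum>i<p. \<bar>a i\<bar>)) * (1 / (1 - \<bar>\<rho>\<bar>)))"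
proof
  define \<Psi> where "\<Psi> = inverse (ar_fps p a) * inverse (ar_fps 1 (\<lambda>_. \<rho>))"
  fix A :: "int set" assume "finite A"
  define N where "N = Suc (nat (Max (insert 0 A)))"
  have "(\<Sum>j\<in>A. \<bar>impulse_response p a \<rho> j\<bar>) = (\<Sum>j\<in>A \<inter> {0..}. \<bar>impulse_response p a \<rho> j\<bar>)"
    using \<open>finite A\<close> by (intro sum.mono_neutral_right) (auto simp: impulse_response_def)
  also have "\<dots> \<le> (\<Sum>j\<in>int ` {..<N}. \<bar>impulse_response p a \<rho> j\<bar>)"
  proof (rule sum_mono2)
    show "A \<inter> {0..} \<subseteq> int ` {..<N}"
    proof
      fix j assume j: "j \<in> A \<inter> {0..}"
      then have "j \<le> Max (insert 0 A)"
        using \<open>finite A\<close> by (intro Max_ge) auto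
      with j show "j \<in> int ` {..<N}"
        by (intro image_eqI[of _ _ "nat j"]) (auto simp: N_def)
    qed
  qed auto
  also have "\<dots> = (\<Sum>n<N. \<bar>fps_nth \<Psi> n\<bar>)"
    by (simp add: sum.reindex impulse_response_def \<Psi>_def)
  also have "\<dots> \<le> (\<Sum>n<N. \<bar>fps_nth (inverse (ar_fps p a)) n\<bar>) * (\<Sum>n<N. \<bar>fps_nth (inverse (ar_fps 1 (\<lambda>_. \<rho>))) n\<bar>)"
    unfolding \<Psi>_def by (rule l1_norm_fps_mult)
  also have "\<dots> \<le> 1 / (1 - (\<Sum>i<p. \<bar>a i\<bar>)) * (1 / (1 - \<bar>\<rho>\<bar>))"
    using l1_norm_inverse_ar_fps[of a p N] l1_norm_inverse_ar_fps[of "\<lambda>_. \<rho>" 1 N] assms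
    by (intro mult_mono sum_nonneg) auto
  finally show "(\<Sum>j\<in>A. \<bar>impulse_response p a \<rho> j\<bar>) \<le> 1 / (1 - (\<Sum>i<p. \<bar>a i\<bar>)) * (1 / (1 - \<bar>\<rho>\<bar>))" .
qed (simp add: impulse_response_def)

text \<open>
  At time 0 both recursions read \<open>x 0 = e 0 = v 0\<close>, so that the initial value plays the part of a
  noise at time 0.
\<close>

lemma ar_process_eq_causal_filter:
  fixes x e v :: "int \<Rightarrow> real"
  assumes neg: "\<And>k. k < 0 \<Longrightarrow> x k = 0" "\<And>k. k < 0 \<Longrightarrow> e k = 0"
    and x: "\<And>n. x (int n) = (\<Sum>i<p. a i * x (int n - 1 - int i)) + e (int n)"
    and e: "\<And>n. e (int n) = \<rho> * e (int n - 1) + v (int n)"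
  shows "x = causal_filter (impulse_response p a \<rho>) v"
proof
  fix k
  show "x k = causal_filter (impulse_response p a \<rho>) v k"
  proof (cases "k < 0")
    case True
    then show ?thesis by (simp add: neg causal_filter_def)
  next
    case False
    define P Q where "P = ar_fps p a" and "Q = ar_fps 1 (\<lambda>_. \<rho>)"
    define fx fe fv where "fx = Abs_fps (\<lambda>n. x (int n))" and "fe = Abs_fps (\<lambda>n. e (int n))"
      and "fv = Abs_fps (\<lambda>n. v (int n))"
    have "P * fx = fe"
      unfolding P_def fx_def fe_def by (rule ar_fps_mult[OF neg(1) x])
    moreover have "Q * fe = fv"
      unfolding Q_def fe_def fv_def
    proof (rule ar_fps_mult[OF neg(2)])
      show "e (int n) = (\<Sum>i<1. \<rho> * e (int n - 1 - int i)) + v (int n)" for n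
        using e[of n] by simp
    qed
    moreover have "fx = inverse P * (P * fx)" "fe = inverse Q * (Q * fe)"
      by (simp_all add: P_def Q_def inverse_mult_eq_1 ar_fps_nth_0 flip: mult.assoc)
    ultimately have "fx = fv * (inverse P * inverse Q)"
      by (simp add: mult_ac)
    then have "fps_nth fx (nat k) = (\<Sum>i=0..nat k. fps_nth fv i * fps_nth (inverse P * inverse Q) (nat k - i))"
      by (simp only: fps_mult_nth)
    also have "\<dots> = (\<Sum>i\<in>int ` {0..nat k}. impulse_response p a \<rho> (k - i) * v i)"
      unfolding P_def Q_def fv_def using False
      by (subst sum.reindex) (auto simp: impulse_response_def nat_diff_distrib intro!: sum.cong)
    also have "int ` {0..nat k} = {0..k}"
      using False by (simp add: image_int_atLeastAtMost)
    finally show ?thesis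
      using False by (simp add: fx_def causal_filter_def)
  qed
qed

section \<open>The least squares residual\<close>

lemma corr_commute: "corr x y i j n = corr y x j i n"
  by (simp add: corr_def mult.commute)

text \<open>
  The Gram matrix is symmetric, and up to boundary terms its entries depend on \<open>i - j\<close> only;
  reversing both indices thus leaves it unchanged up to sublinear errors.
\<close>

lemma corr_persymmetric:
  assumes "(\<lambda>k. (x (int k))\<^sup>2) \<in> o(real)"
  shows "(\<lambda>n. corr x x (q - i) (q - j) n - corr x x i j n) \<in> o(real)"
  using corr_shift_smallo[OF assms assms, of i "q - i - j" j]
  by (simp add: corr_commute[of x x "q - i"])

text \<open>
  With \<open>D i\<close> the \<open>i\<close>-th residual of the normal equations at \<open>t\<close>, multiplying the recursion for
  \<open>x\<^sub>k\<^sub>+\<^sub>1\<close> by \<open>x\<^sub>k\<^sub>-\<^sub>i\<close> expresses \<open>corr x x i (-1) + c corr x x i p\<close> through the Gram matrix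
  applied to \<open>\<beta>\<close> and the correlation with the next noise.
  By persymmetry \<open>corr x x i p\<close> may be replaced by \<open>corr x x (p - 1 - i) (-1)\<close>, and the Gram matrix
  commutes with the reversal \<open>j \<mapsto> p - 1 - j\<close>. Since \<open>\<beta>\<close> is \<open>t\<close> plus \<open>c\<close> times its reversal, what
  remains is that \<open>D i + c D (p - 1 - i)\<close> is the correlation of the regressor with the next noise, up
  to boundary terms, and thus sublinear. This system, which couples \<open>i\<close> with \<open>p - 1 - i\<close>, is
  invertible for \<open>c\<^sup>2 \<noteq> 1\<close>.
\<close>

lemma normal_equation_residual_smallo:
  fixes x v :: "int \<Rightarrow> real" and \<beta> t :: "nat \<Rightarrow> real" and c :: real
  assumes x_sq: "(\<lambda>k. (x (int k))\<^sup>2) \<in> o(real)"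
    and rec: "\<And>k. x (int k + 1) = (\<Sum>j<p. \<beta> j * x (int k - int j)) - c * x (int k - int p) + v (int k + 1)"
    and innov: "\<And>i. i < p \<Longrightarrow> corr x v (int i) (- 1) \<in> o(real)"
    and c: "c\<^sup>2 \<noteq> 1"
    and t: "\<And>j. j < p \<Longrightarrow> t j + c * t (p - 1 - j) = \<beta> j"
    and i: "i < p"
  shows "(\<lambda>n. corr x x (int i) (- 1) n - (\<Sum>j<p. corr x x (int i) (int j) n * t j)) \<in> o(real)"
proof -
  define D where "D i n = corr x x (int i) (- 1) n - (\<Sum>j<p. corr x x (int i) (int j) n * t j)" for i n
  define q where "q = int p - 1"
  define P where "P i j n = corr x x (q - i) (q - j) n - corr x x i j n" for i j n
  have P_small: "(\<lambda>n. P i j n) \<in> o(real)" for i j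
    unfolding P_def by (rule corr_persymmetric[OF x_sq])
  have R: "(\<lambda>n. D i n + c * D (p - 1 - i) n) \<in> o(real)" if i: "i < p" for i
  proof -
    have qi: "int (p - 1 - i) = q - int i"
      using i by (simp add: q_def of_nat_diff)
    have "D i n + c * D (p - 1 - i) n = corr x v (int i) (- 1) n
        + c * (P (int i) (int p) n - (\<Sum>j<p. t (p - 1 - j) * P (int i) (int j) n))" for n
    proof -
      have "(\<Sum>j<p. corr x x (q - int i) (int j) n * t j)
          = (\<Sum>j<p. corr x x (q - int i) (int (p - Suc j)) n * t (p - Suc j))"
        by (rule sum.nat_diff_reindex[symmetric])
      also have "\<dots> = (\<Sum>j<p. corr x x (q - int i) (q - int j) n * t (p - 1 - j))"
        by (intro sum.cong) (auto simp: q_def of_nat_diff algebra_simps)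
      also have "\<dots> = (\<Sum>j<p. t (p - 1 - j) * P (int i) (int j) n)
          + (\<Sum>j<p. corr x x (int i) (int j) n * t (p - 1 - j))"
        by (simp add: P_def sum.distrib[symmetric] algebra_simps)
      finally have 1: "D (p - 1 - i) n = P (int i) (int p) n + corr x x (int i) (int p) n
          - (\<Sum>j<p. t (p - 1 - j) * P (int i) (int j) n)
          - (\<Sum>j<p. corr x x (int i) (int j) n * t (p - 1 - j))"
        unfolding D_def qi by (simp add: P_def q_def)
      have "corr x x (int i) (- 1) n = (\<Sum>k<n. x (int k - int i) *
          ((\<Sum>j<p. \<beta> j * x (int k - int j)) - c * x (int k - int p) + v (int k + 1)))"
        by (simp add: corr_def rec)
      also have "\<dots> = (\<Sum>j<p. corr x x (int i) (int j) n * \<beta> j) - c * corr x x (int i) (int p) n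
          + corr x v (int i) (- 1) n"
      proof -
        have "(\<Sum>k<n. x (int k - int i) * (\<Sum>j<p. \<beta> j * x (int k - int j)))
            = (\<Sum>j<p. corr x x (int i) (int j) n * \<beta> j)"
          unfolding corr_def sum_distrib_left sum_distrib_right
          by (subst sum.swap) (simp add: mult_ac)
        then show ?thesis
          by (simp add: algebra_simps sum.distrib sum_subtractf corr_def sum_distrib_left)
      qed
      also have "(\<Sum>j<p. corr x x (int i) (int j) n * \<beta> j) = (\<Sum>j<p. corr x x (int i) (int j) n * t j)
          + c * (\<Sum>j<p. corr x x (int i) (int j) n * t (p - 1 - j))"
        unfolding sum_distrib_left sum.distrib[symmetric]
        by (intro sum.cong) (auto simp: t[symmetric] algebra_simps)
      finally have 2: "D i n = c * (\<Sum>j<p. corr x x (int i) (int j) n * t (p - 1 - j))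
          - c * corr x x (int i) (int p) n + corr x v (int i) (- 1) n"
        by (simp add: D_def)
      show ?thesis
        unfolding 1 2 by (simp add: algebra_simps)
    qed
    moreover have "(\<lambda>n. corr x v (int i) (- 1) n
        + c * (P (int i) (int p) n - (\<Sum>j<p. t (p - 1 - j) * P (int i) (int j) n))) \<in> o(real)"
      by (intro sum_in_smallo innov i cmult_smallo_real big_sum_in_smallo P_small)
    ultimately show ?thesis
      by simp
  qed
  have "(\<lambda>n. 1 / (1 - c\<^sup>2) * ((D i n + c * D (p - 1 - i) n)
      - c * (D (p - 1 - i) n + c * D (p - 1 - (p - 1 - i)) n))) \<in> o(real)"
    using i by (intro cmult_smallo_real sum_in_smallo R) auto
  moreover have "1 / (1 - c\<^sup>2) * ((D i n + c * D (p - 1 - i) n)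
      - c * (D (p - 1 - i) n + c * D (p - 1 - (p - 1 - i)) n)) = D i n" for n
  proof -
    have "(D i n + c * D (p - 1 - i) n) - c * (D (p - 1 - i) n + c * D (p - 1 - (p - 1 - i)) n)
        = (1 - c\<^sup>2) * D i n"
      using i by (simp add: algebra_simps power2_eq_square)
    then show ?thesis
      using c by simp
  qed
  ultimately show ?thesis
    by (simp add: D_def)
qed

section \<open>The least squares estimator\<close>

lemma scalar_prod_mult_mat_vec:
  fixes v :: "real vec"
  assumes "v \<in> carrier_vec p" "A \<in> carrier_mat p p"
  shows "v \<bullet> (A *\<^sub>v v) = (\<Sum>i<p. \<Sum>j<p. v $ i * v $ j * A $$ (i, j))"
proof -
  have "v \<bullet> (A *\<^sub>v v) = (\<Sum>i<p. v $ i * (\<Sum>j<p. A $$ (i, j) * v $ j))"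
    using assms by (auto simp: scalar_prod_def atLeast0LessThan intro!: sum.cong)
  also have "\<dots> = (\<Sum>i<p. \<Sum>j<p. v $ i * v $ j * A $$ (i, j))"
    unfolding sum_distrib_left by (intro sum.cong refl) (simp add: mult_ac)
  finally show ?thesis .
qed

lemma design_mat_entry:
  assumes "S \<in> carrier_mat p p" "n \<ge> 1" "i < p" "j < p"
  shows "design_mat p S x (n - 1) $$ (i, j) = corr x x (int i) (int j) n + S $$ (i, j)"
proof -
  have "{0..n - 1} = {..<n}"
    using \<open>n \<ge> 1\<close> by auto
  then show ?thesis
    using assms by (auto simp: design_mat_def regressor_def corr_def)
qed

lemma sym_pos_def_mat_nonneg:
  assumes "sym_pos_def_mat p S"
  shows "0 \<le> (\<Sum>i<p. \<Sum>j<p. u i * u j * S $$ (i, j))"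
proof (cases "vec p u = 0\<^sub>v p")
  case True
  then have "u i = 0" if "i < p" for i
    using that by (metis index_vec index_zero_vec(1))
  then show ?thesis by simp
next
  case False
  then have "0 < vec p u \<bullet> (S *\<^sub>v vec p u)"
    using assms by (simp add: sym_pos_def_mat_def)
  also have "\<dots> = (\<Sum>i<p. \<Sum>j<p. u i * u j * S $$ (i, j))"
    using assms by (subst scalar_prod_mult_mat_vec[of _ p]) (auto simp: sym_pos_def_mat_def)
  finally show ?thesis by simp
qed

lemma sum_corr_eq_sum_squares:
  "(\<Sum>i<p. \<Sum>j<p. u i * u j * corr x x (int i) (int j) n) = (\<Sum>k<n. (\<Sum>i<p. u i * x (int k - int i))\<^sup>2)"
  by (simp add: sum_mult_linear_combinations power2_eq_square)

lemma ls_estimator_normal_equations: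
  assumes S: "sym_pos_def_mat p S" and n: "n \<ge> 1" and i: "i < p"
  shows "(\<Sum>j<p. (corr x x (int i) (int j) n + S $$ (i, j)) * ls_estimator p S x n $ j)
    = corr x x (int i) (- 1) n"
proof -
  define A where "A = design_mat p S x (n - 1)"
  define b where "b = vec p (\<lambda>i. \<Sum>k=1..n. regressor p x (k - 1) $ i * x (int k))"
  have S_carrier: "S \<in> carrier_mat p p"
    using S by (simp add: sym_pos_def_mat_def)
  then have A: "A \<in> carrier_mat p p"
    by (simp add: A_def design_mat_def)
  have "Determinant.det A \<noteq> 0"
  proof
    assume "Determinant.det A = 0"
    then obtain w where w: "w \<in> carrier_vec p" "w \<noteq> 0\<^sub>v p" "A *\<^sub>v w = 0\<^sub>v p"
      using det_0_iff_vec_prod_zero_field[OF A] by auto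
    have "0 < w \<bullet> (S *\<^sub>v w)"
      using w S by (simp add: sym_pos_def_mat_def)
    also have "\<dots> \<le> (\<Sum>k<n. (\<Sum>i<p. w $ i * x (int k - int i))\<^sup>2) + w \<bullet> (S *\<^sub>v w)"
      by (simp add: sum_nonneg)
    also have "\<dots> = w \<bullet> (A *\<^sub>v w)"
      using w(1) A S_carrier n
      by (simp add: scalar_prod_mult_mat_vec[of _ p] A_def design_mat_entry distrib_left sum.distrib
          del: One_nat_def flip: sum_corr_eq_sum_squares)
    also have "\<dots> = 0"
      using w by simp
    finally show False by simp
  qed
  then have "A \<in> Units (ring_mat TYPE(real) p ())"
    by (rule det_non_zero_imp_unit[OF A])
  then obtain C where C: "mat_inverse A = Some C"
    using mat_inverse(1)[OF A, where b = "()"] by auto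
  then have AC: "A * C = 1\<^sub>m p" "C \<in> carrier_mat p p"
    using mat_inverse(2)[OF A C] by auto
  have b: "b \<in> carrier_vec p"
    by (simp add: b_def)
  define L where "L = ls_estimator p S x n"
  have L_eq: "L = C *\<^sub>v b"
    using C by (simp add: L_def ls_estimator_def A_def b_def)
  have "A *\<^sub>v L = b"
    unfolding L_eq assoc_mult_mat_vec[OF A AC(2) b, symmetric] AC(1) using b by simp
  have L: "L \<in> carrier_vec p"
    unfolding L_eq by (rule mult_mat_vec_carrier[OF AC(2) b])
  have "(A *\<^sub>v L) $ i = b $ i"
    using \<open>A *\<^sub>v L = b\<close> by simp
  moreover have "(A *\<^sub>v L) $ i = (\<Sum>j<p. A $$ (i, j) * L $ j)"
    using A L i by (auto simp: scalar_prod_def atLeast0LessThan intro!: sum.cong)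
  moreover have "b $ i = corr x x (int i) (- 1) n"
    using i by (simp add: b_def corr_def regressor_def sum.atLeast1_atMost_eq add.commute)
  ultimately show ?thesis
    using S_carrier n i by (simp add: A_def L_def design_mat_entry del: One_nat_def)
qed

text \<open>
  The estimation error \<open>u\<close> solves the linear system with the design matrix on the left and the
  residual of the normal equations at \<open>t\<close> on the right. Pairing this system with \<open>u\<close>, the left side is at
  least of order \<open>n \<parallel>u\<parallel>\<^sup>2\<close> while the right side is at most \<open>\<parallel>u\<parallel>\<close> times a sublinear quantity.
\<close>

lemma ls_estimator_tendsto:
  fixes x :: "int \<Rightarrow> real" and t :: "nat \<Rightarrow> real"
  assumes S: "sym_pos_def_mat p S"
    and \<kappa>: "\<kappa> > 0" "eventually (\<lambda>n. \<forall>u. \<kappa> * real n * (\<Sum>i<p. \<bar>u i\<bar>)\<^sup>2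
      \<le> (\<Sum>k<n. (\<Sum>i<p. u i * x (int k - int i))\<^sup>2)) sequentially"
    and residual: "\<And>i. i < p \<Longrightarrow>
      (\<lambda>n. corr x x (int i) (- 1) n - (\<Sum>j<p. corr x x (int i) (int j) n * t j)) \<in> o(real)"
    and i: "i < p"
  shows "(\<lambda>n. ls_estimator p S x n $ i) \<longlonglongrightarrow> t i"
proof -
  define r where "r i n = corr x x (int i) (- 1) n - (\<Sum>j<p. corr x x (int i) (int j) n * t j)
    - (\<Sum>j<p. S $$ (i, j) * t j)" for i n
  define R where "R n = (\<Sum>i<p. \<bar>r i n\<bar>)" for n
  have r_small: "(\<lambda>n. r i n) \<in> o(real)" if "i < p" for i
    unfolding r_def using that by (intro sum_in_smallo residual const_smallo_real)
  have "R \<in> o(real)"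
    unfolding R_def by (intro big_sum_in_smallo) (use r_small in auto)
  then have lim: "(\<lambda>n. inverse \<kappa> * (R n / real n)) \<longlonglongrightarrow> 0"
    unfolding smallo_real_iff by (rule tendsto_mult_right_zero)
  have "eventually (\<lambda>n. norm (ls_estimator p S x n $ i - t i) \<le> inverse \<kappa> * (R n / real n)) sequentially"
    using \<kappa>(2) eventually_ge_at_top[of 1]
  proof eventually_elim
    case (elim n)
    define u where "u j = ls_estimator p S x n $ j - t j" for j
    define s where "s = (\<Sum>i<p. \<bar>u i\<bar>)"
    have "s \<ge> 0" by (simp add: s_def sum_nonneg)
    have normal: "(\<Sum>j<p. (corr x x (int i) (int j) n + S $$ (i, j)) * u j) = r i n" if "i < p" for i
      using ls_estimator_normal_equations[OF S elim(2) that, of x]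
      by (simp add: u_def r_def algebra_simps sum.distrib sum_subtractf)
    have "\<kappa> * real n * s\<^sup>2 \<le> (\<Sum>i<p. \<Sum>j<p. u i * u j * corr x x (int i) (int j) n)"
      using elim(1) by (simp add: s_def sum_corr_eq_sum_squares)
    also have "\<dots> \<le> (\<Sum>i<p. \<Sum>j<p. u i * u j * corr x x (int i) (int j) n)
        + (\<Sum>i<p. \<Sum>j<p. u i * u j * S $$ (i, j))"
      using sym_pos_def_mat_nonneg[OF S] by simp
    also have "\<dots> = (\<Sum>i<p. u i * (\<Sum>j<p. (corr x x (int i) (int j) n + S $$ (i, j)) * u j))"
      by (simp add: sum_distrib_left sum.distrib[symmetric] algebra_simps)
    also have "\<dots> = (\<Sum>i<p. u i * r i n)"
      by (intro sum.cong) (auto simp: normal)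
    also have "\<dots> \<le> (\<Sum>i<p. s * \<bar>r i n\<bar>)"
    proof (rule sum_mono)
      fix i assume i: "i \<in> {..<p}"
      have "\<bar>u i\<bar> \<le> s"
        unfolding s_def using i by (intro member_le_sum[where f = "\<lambda>i. \<bar>u i\<bar>"]) auto
      then have "\<bar>u i\<bar> * \<bar>r i n\<bar> \<le> s * \<bar>r i n\<bar>"
        by (intro mult_right_mono) auto
      then show "u i * r i n \<le> s * \<bar>r i n\<bar>"
        by (metis abs_ge_self abs_mult order_trans)
    qed
    also have "\<dots> = s * R n"
      by (simp add: R_def sum_distrib_left)
    finally have *: "s * (\<kappa> * real n * s) \<le> s * R n"
      by (simp add: power2_eq_square mult_ac)
    have "\<kappa> * real n * s \<le> R n"
    proof (cases "s = 0")
      case True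
      then show ?thesis by (simp add: R_def sum_nonneg)
    next
      case False
      with \<open>s \<ge> 0\<close> have "s > 0" by simp
      with * show ?thesis by simp
    qed
    then have "s \<le> inverse \<kappa> * (R n / real n)"
      using \<kappa>(1) elim(2) by (simp add: field_simps)
    moreover have "\<bar>u i\<bar> \<le> s"
      unfolding s_def using i by (intro member_le_sum[where f = "\<lambda>i. \<bar>u i\<bar>"]) auto
    ultimately show ?case
      by (simp add: u_def)
  qed
  then have "(\<lambda>n. ls_estimator p S x n $ i - t i) \<longlonglongrightarrow> 0"
    by (rule Lim_null_comparison[OF _ lim])
  then show ?thesis
    by (simp add: LIM_zero_iff)
qed

lemma ls_estimator_cong:
  assumes "\<And>k. - int p < k \<Longrightarrow> x k = y k" "p \<ge> 1"
  shows "ls_estimator p S x n = ls_estimator p S y n"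
proof -
  have "regressor p x k = regressor p y k" for k
    unfolding regressor_def by (rule eq_vecI) (use assms in auto)
  then have "design_mat p S x m = design_mat p S y m" for m
    by (simp add: design_mat_def)
  then show ?thesis
    using \<open>\<And>k. regressor p x k = regressor p y k\<close> assms by (simp add: ls_estimator_def)
qed

lemma theta_star_entry:
  assumes "i < p"
  shows "theta_star p \<theta> \<rho> $ i = alpha_const p \<theta> \<rho> *
    (beta_vec p \<theta> \<rho> $ i - \<theta> $ (p - 1) * \<rho> * beta_vec p \<theta> \<rho> $ (p - 1 - i))"
proof -
  have b: "beta_vec p \<theta> \<rho> \<in> carrier_vec p"
    by (simp add: beta_vec_def)
  have "((1\<^sub>m p - (\<theta> $ (p - 1) * \<rho>) \<cdot>\<^sub>m exchange_mat p) *\<^sub>v beta_vec p \<theta> \<rho>) $ i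
      = (\<Sum>j<p. ((if i = j then 1 else 0) - \<theta> $ (p - 1) * \<rho> * (if i + j = p - 1 then 1 else 0)) * beta_vec p \<theta> \<rho> $ j)"
    using assms b by (auto simp: scalar_prod_def exchange_mat_def atLeast0LessThan intro!: sum.cong)
  also have "\<dots> = (\<Sum>j<p. if j = i then beta_vec p \<theta> \<rho> $ j else 0)
      - \<theta> $ (p - 1) * \<rho> * (\<Sum>j<p. if j = p - 1 - i then beta_vec p \<theta> \<rho> $ j else 0)"
    unfolding sum_distrib_left sum_subtractf[symmetric]
    by (intro sum.cong) (use assms in \<open>auto simp: algebra_simps\<close>)
  also have "\<dots> = beta_vec p \<theta> \<rho> $ i - \<theta> $ (p - 1) * \<rho> * beta_vec p \<theta> \<rho> $ (p - 1 - i)"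
    using assms by simp
  finally show ?thesis
    using assms by (simp add: theta_star_def exchange_mat_def)
qed

text \<open>
  The matrix \<open>\<alpha> (I - c J)\<close> is the inverse of \<open>I + c J\<close>, because \<open>J\<^sup>2 = I\<close> and \<open>\<alpha> = 1 / (1 - c\<^sup>2)\<close>,
  where \<open>c = \<theta>\<^sub>p \<rho>\<close>.
\<close>

lemma theta_star_equation:
  assumes "i < p" and c: "(\<theta> $ (p - 1) * \<rho>)\<^sup>2 \<noteq> 1"
  shows "theta_star p \<theta> \<rho> $ i + \<theta> $ (p - 1) * \<rho> * theta_star p \<theta> \<rho> $ (p - 1 - i) = beta_vec p \<theta> \<rho> $ i"
proof -
  define c where "c = \<theta> $ (p - 1) * \<rho>"
  define b where "b = beta_vec p \<theta> \<rho>"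
  have refl: "p - 1 - (p - 1 - i) = i" "p - 1 - i < p"
    using assms(1) by auto
  have "alpha_const p \<theta> \<rho> * (1 - c\<^sup>2) = 1"
    using c by (simp add: alpha_const_def c_def power2_eq_square algebra_simps)
  then have "b $ i = alpha_const p \<theta> \<rho> * (1 - c\<^sup>2) * b $ i"
    by simp
  also have "\<dots> = alpha_const p \<theta> \<rho> * (b $ i - c * b $ (p - 1 - i))
      + c * (alpha_const p \<theta> \<rho> * (b $ (p - 1 - i) - c * b $ i))"
    by (simp add: algebra_simps power2_eq_square)
  finally show ?thesis
    using assms(1) refl by (simp only: theta_star_entry refl b_def c_def)
qed

text \<open>
  Eliminating the coloured noise \<open>e\<close> turns the process into an autoregression of order \<open>p + 1\<close>
  driven by \<open>v\<close>. Its first \<open>p\<close> coefficients are \<open>\<beta>\<close>; the last one, of \<open>x\<^sub>k\<^sub>-\<^sub>p\<close>, lies outside the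
  regressor and is the source of the bias of the estimator.
\<close>

lemma ar_process_innovation_form:
  fixes x e v :: "int \<Rightarrow> real"
  assumes p: "p \<ge> 1"
    and x: "\<And>n. x (int n) = (\<Sum>i<p. \<theta> $ i * x (int n - 1 - int i)) + e (int n)"
    and e: "\<And>n. e (int n) = \<rho> * e (int n - 1) + v (int n)"
  shows "x (int k + 1) = (\<Sum>j<p. beta_vec p \<theta> \<rho> $ j * x (int k - int j))
    - \<theta> $ (p - 1) * \<rho> * x (int k - int p) + v (int k + 1)"
proof -
  obtain m where m: "p = Suc m"
    using p by (cases p) auto
  have "(\<Sum>j<p. beta_vec p \<theta> \<rho> $ j * x (int k - int j))
      = (\<theta> $ 0 + \<rho>) * x (int k) + (\<Sum>j<m. (\<theta> $ Suc j - \<theta> $ j * \<rho>) * x (int k - 1 - int j))"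
    unfolding m by (subst sum.lessThan_Suc_shift) (simp add: beta_vec_def algebra_simps)
  also have "\<dots> = \<rho> * x (int k) + (\<theta> $ 0 * x (int k) + (\<Sum>j<m. \<theta> $ Suc j * x (int k - 1 - int j)))
      - \<rho> * (\<Sum>j<m. \<theta> $ j * x (int k - 1 - int j))"
    by (simp add: algebra_simps sum_subtractf sum_distrib_left)
  also have "\<theta> $ 0 * x (int k) + (\<Sum>j<m. \<theta> $ Suc j * x (int k - 1 - int j)) = (\<Sum>j<p. \<theta> $ j * x (int k - int j))"
    unfolding m using sum.lessThan_Suc_shift[of "\<lambda>j. \<theta> $ j * x (int k - int j)" m]
    by (simp add: algebra_simps)
  also have "(\<Sum>j<m. \<theta> $ j * x (int k - 1 - int j)) = (\<Sum>j<p. \<theta> $ j * x (int k - 1 - int j)) - \<theta> $ (p - 1) * x (int k - int p)"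
    by (simp add: m algebra_simps)
  finally have b: "(\<Sum>j<p. beta_vec p \<theta> \<rho> $ j * x (int k - int j)) - \<theta> $ (p - 1) * \<rho> * x (int k - int p)
      = (\<Sum>j<p. \<theta> $ j * x (int k - int j)) + \<rho> * (x (int k) - (\<Sum>j<p. \<theta> $ j * x (int k - 1 - int j)))"
    by (simp add: algebra_simps)
  have "x (int k) - (\<Sum>j<p. \<theta> $ j * x (int k - 1 - int j)) = e (int k)"
    using x[of k] by simp
  moreover have "x (int k + 1) = (\<Sum>j<p. \<theta> $ j * x (int k - int j)) + e (int k + 1)"
    using x[of "Suc k"] by (simp add: add.commute)
  moreover have "e (int k + 1) = \<rho> * e (int k) + v (int k + 1)"
    using e[of "Suc k"] by (simp add: add.commute)
  ultimately show ?thesis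
    using b by simp
qed

text \<open>
  For the identity filter, the correlation statement about filters becomes the one about lagged
  products of the noise itself.
\<close>

lemma stable_impulse_response_unit: "stable_impulse_response (\<lambda>j. of_bool (j = 0)) 1"
proof
  fix A :: "int set" assume "finite A"
  have "(\<Sum>j\<in>A. \<bar>of_bool (j = 0) :: real\<bar>) = (\<Sum>j\<in>A. if j = 0 then 1 else 0)"
    by (intro sum.cong) auto
  also have "\<dots> \<le> 1"
    using \<open>finite A\<close> by simp
  finally show "(\<Sum>j\<in>A. \<bar>of_bool (j = 0) :: real\<bar>) \<le> 1" .
qed simp

lemma causal_filter_unit:
  assumes "\<And>k. k < 0 \<Longrightarrow> v k = 0"
  shows "causal_filter (\<lambda>j. of_bool (j = 0)) v = v"
proof
  fix k
  have "causal_filter (\<lambda>j. of_bool (j = 0)) v k = (\<Sum>i\<in>{0..k}. if i = k then v i else 0)"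
    unfolding causal_filter_def by (intro sum.cong) auto
  then show "causal_filter (\<lambda>j. of_bool (j = 0)) v k = v k"
    using assms by simp
qed

section \<open>Almost sure convergence\<close>

theorem theorem2p1:
  fixes M :: "'a measure" and p :: nat and \<theta> :: "real vec" and \<rho> \<sigma> :: real
    and X :: "int \<Rightarrow> 'a \<Rightarrow> real" and \<epsilon> V :: "nat \<Rightarrow> 'a \<Rightarrow> real" and S :: "real mat"
  assumes prob: "prob_space M"
    and p: "p \<ge> 1"
    and theta: "\<theta> \<in> carrier_vec p" "\<theta> \<noteq> 0\<^sub>v p" "(\<Sum>i<p. \<bar>\<theta> $ i\<bar>) < 1"
    and rho: "\<bar>\<rho>\<bar> < 1"
    and V_indep: "prob_space.indep_vars M (\<lambda>_. borel) V {1..}"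
    and V_ident: "\<And>n. n \<ge> 1 \<Longrightarrow> distr M borel (V n) = distr M borel (V 1)"
    and V_sq: "\<And>n. n \<ge> 1 \<Longrightarrow> integrable M (\<lambda>\<omega>. (V n \<omega>)\<^sup>2)"
    and V_mean: "\<And>n. n \<ge> 1 \<Longrightarrow> prob_space.expectation M (V n) = 0"
    and V_var: "\<And>n. n \<ge> 1 \<Longrightarrow> prob_space.variance M (V n) = \<sigma>\<^sup>2"
    and sigma: "\<sigma>\<^sup>2 > 0"
    and init_meas: "X 0 \<in> borel_measurable M"
    and init_sq: "integrable M (\<lambda>\<omega>. (X 0 \<omega>)\<^sup>2)"
    and init_eps: "\<And>\<omega>. \<omega> \<in> space M \<Longrightarrow> X 0 \<omega> = \<epsilon> 0 \<omega>"
    and init_neg: "\<And>i \<omega>. 1 \<le> i \<Longrightarrow> i \<le> p \<Longrightarrow> \<omega> \<in> space M \<Longrightarrow> X (- int i) \<omega> = 0"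
    and X_rec: "\<And>n \<omega>. n \<ge> 1 \<Longrightarrow> \<omega> \<in> space M \<Longrightarrow>
      X (int n) \<omega> = (\<Sum>i=1..p. \<theta> $ (i - 1) * X (int n - int i) \<omega>) + \<epsilon> n \<omega>"
    and eps_rec: "\<And>n \<omega>. n \<ge> 1 \<Longrightarrow> \<omega> \<in> space M \<Longrightarrow>
      \<epsilon> n \<omega> = \<rho> * \<epsilon> (n - 1) \<omega> + V n \<omega>"
    and S: "sym_pos_def_mat p S"
  shows "AE \<omega> in M. \<forall>i<p.
    (\<lambda>n. ls_estimator p S (\<lambda>k. X k \<omega>) n $ i) \<longlonglongrightarrow> theta_star p \<theta> \<rho> $ i"
proof -
  interpret prob_space M by (rule prob)
  interpret iid_white_noise M V "\<sigma>\<^sup>2"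
  proof unfold_locales
    show "expectation (\<lambda>\<omega>. (V k \<omega>)\<^sup>2) = \<sigma>\<^sup>2" if "k \<ge> 1" for k
      using V_var[OF that] V_mean[OF that] by simp
  qed (fact V_indep V_sq V_mean V_ident)+
  \<comment> \<open>\<open>X\<close> is arbitrary before time \<open>-p\<close>; the trajectories \<open>x\<close> vanish at all negative times.\<close>
  define x where "x \<omega> k = (if k < 0 then 0 else X k \<omega>)" for \<omega> k
  define e where "e \<omega> k = (if k < 0 then 0 else \<epsilon> (nat k) \<omega>)" for \<omega> k
  define v where "v k \<omega> = (if k < 0 then 0 else if k = 0 then X 0 \<omega> else V (nat k) \<omega>)" for k \<omega>
  define \<psi> where "\<psi> = impulse_response p (\<lambda>i. \<theta> $ i) \<rho>"
  obtain B where stable: "stable_impulse_response \<psi> B"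
    unfolding \<psi>_def using stable_impulse_response_ar[OF theta(3) rho] by blast
  interpret \<psi>: stable_impulse_response \<psi> B by (rule stable)
  have v_neg: "v k \<omega> = 0" if "k < 0" for k \<omega>
    using that by (simp add: v_def)
  have v_pos: "v (int k) = V k" if "k \<ge> 1" for k
    using that by (auto simp: v_def)
  have x_rec: "x \<omega> (int n) = (\<Sum>i<p. \<theta> $ i * x \<omega> (int n - 1 - int i)) + e \<omega> (int n)"
    if "\<omega> \<in> space M" for \<omega> n
  proof (cases "n = 0")
    case True
    then show ?thesis
      using init_eps[OF that] by (simp add: x_def e_def)
  next
    case False
    have "(\<Sum>i=1..p. \<theta> $ (i - 1) * X (int n - int i) \<omega>) = (\<Sum>i<p. \<theta> $ i * X (int n - int (Suc i)) \<omega>)"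
      by (simp add: sum.atLeast1_atMost_eq)
    also have "\<dots> = (\<Sum>i<p. \<theta> $ i * x \<omega> (int n - 1 - int i))"
    proof (intro sum.cong refl)
      fix i assume i: "i \<in> {..<p}"
      have "X (int n - int (Suc i)) \<omega> = x \<omega> (int n - int (Suc i))"
      proof (cases "int n - int (Suc i) < 0")
        case True
        then have "int n - int (Suc i) = - int (Suc i - n)"
          by (simp add: of_nat_diff)
        moreover have "X (- int (Suc i - n)) \<omega> = 0"
          using True i that by (intro init_neg) auto
        ultimately show ?thesis
          using True by (simp add: x_def)
      qed (simp add: x_def)
      then show "\<theta> $ i * X (int n - int (Suc i)) \<omega> = \<theta> $ i * x \<omega> (int n - 1 - int i)"
        by (simp add: algebra_simps)
    qed
    finally show ?thesis
      using X_rec[of n, OF _ that] False by (simp add: x_def e_def)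
  qed
  have e_rec: "e \<omega> (int n) = \<rho> * e \<omega> (int n - 1) + v (int n) \<omega>" if "\<omega> \<in> space M" for \<omega> n
  proof (cases "n = 0")
    case False
    then have "nat (int n - 1) = n - 1"
      by auto
    then show ?thesis
      using eps_rec[of n, OF _ that] False by (simp add: e_def v_def)
  qed (simp add: e_def v_def init_eps[OF that])
  have x_filter: "x \<omega> = causal_filter \<psi> (\<lambda>k. v k \<omega>)" if "\<omega> \<in> space M" for \<omega>
    unfolding \<psi>_def
    by (rule ar_process_eq_causal_filter[OF _ _ x_rec[OF that] e_rec[OF that]])
      (simp_all add: x_def e_def)
  have c: "(\<theta> $ (p - 1) * \<rho>)\<^sup>2 \<noteq> 1"
  proof -
    have "\<bar>\<theta> $ (p - 1)\<bar> \<le> (\<Sum>i<p. \<bar>\<theta> $ i\<bar>)"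
      using p by (intro member_le_sum[where f = "\<lambda>i. \<bar>\<theta> $ i\<bar>"]) auto
    then have "\<bar>\<theta> $ (p - 1)\<bar> * \<bar>\<rho>\<bar> < 1 * 1"
      using theta(3) rho by (intro mult_strict_mono') auto
    then have "\<bar>\<theta> $ (p - 1) * \<rho>\<bar> < 1"
      by (simp add: abs_mult)
    then have "(\<theta> $ (p - 1) * \<rho>)\<^sup>2 < 1"
      by (simp add: abs_square_less_1)
    then show ?thesis by simp
  qed
  have corr_filter: "AE \<omega> in M. \<forall>i j. (\<lambda>n. corr (causal_filter \<phi> (\<lambda>k. v k \<omega>)) (\<lambda>k. v k \<omega>) i j n
      - \<phi> (j - i) * (\<Sum>k<n. (v (int k) \<omega>)\<^sup>2)) \<in> o(real)"
    if "stable_impulse_response \<phi> C" for \<phi> C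
    by (rule AE_corr_causal_filter[OF that _ _ AE_noise_square_smallo]) (simp_all add: v_neg v_pos)
  from AE_space AE_noise_square_smallo AE_noise_energy_lower_bound[OF sigma]
    corr_filter[OF stable] corr_filter[OF stable_impulse_response_unit]
  show ?thesis
  proof eventually_elim
    case (elim \<omega>)
    define N where "N n = (\<Sum>k<n. (v (int k) \<omega>)\<^sup>2)" for n
    have cross: "(\<lambda>n. corr (x \<omega>) (\<lambda>k. v k \<omega>) i j n - \<psi> (j - i) * N n) \<in> o(real)" for i j
      using elim(4) by (simp add: x_filter[OF elim(1)] N_def)
    have white: "(\<lambda>n. corr (\<lambda>k. v k \<omega>) (\<lambda>k. v k \<omega>) i j n - of_bool (i = j) * N n) \<in> o(real)" for i j
      using elim(5)[rule_format, of i j]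
      by (cases "i = j") (simp_all add: causal_filter_unit v_neg N_def)
    have "(\<lambda>k. (v (int k) \<omega>)\<^sup>2) \<in> o(real)"
    proof (rule landau_o.small.in_cong[THEN iffD2])
      show "(\<lambda>k. (V k \<omega>)\<^sup>2) \<in> o(real)" by (rule elim(2))
      show "eventually (\<lambda>k. (v (int k) \<omega>)\<^sup>2 = (V k \<omega>)\<^sup>2) sequentially"
        by (rule eventually_sequentiallyI[of 1]) (simp add: v_pos)
    qed
    then have x_sq: "(\<lambda>k. (x \<omega> (int k))\<^sup>2) \<in> o(real)"
      unfolding x_filter[OF elim(1)] by (rule \<psi>.causal_filter_square_smallo)
    obtain c where c_pos: "c > 0"
      and c_le: "eventually (\<lambda>n. c * real n \<le> (\<Sum>k=1..n. (V k \<omega>)\<^sup>2)) sequentially"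
      using elim(3) by blast
    have "eventually (\<lambda>n. c / 2 * real n \<le> N n) sequentially"
    proof (rule eventually_sequentially_Suc[THEN iffD1])
      show "eventually (\<lambda>n. c / 2 * real (Suc n) \<le> N (Suc n)) sequentially"
        using c_le eventually_ge_at_top[of 1]
      proof eventually_elim
        case (elim n)
        have "c / 2 * real (Suc n) \<le> c * real n"
          using elim(2) c_pos by simp
        also have "\<dots> \<le> (\<Sum>k=1..n. (V k \<omega>)\<^sup>2)"
          by (rule elim(1))
        also have "\<dots> = (\<Sum>k=1..n. (v (int k) \<omega>)\<^sup>2)"
          by (intro sum.cong) (auto simp: v_pos)
        also have "\<dots> \<le> N (Suc n)"
          unfolding N_def by (intro sum_mono2) auto
        finally show ?case .
      qed
    qed
    then obtain \<kappa> where \<kappa>: "\<kappa> > 0" "eventually (\<lambda>n. \<forall>u. \<kappa> * real n * (\<Sum>i<p. \<bar>u i\<bar>)\<^sup>2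
        \<le> (\<Sum>k<n. (\<Sum>i<p. u i * x \<omega> (int k - int i))\<^sup>2)) sequentially"
      using persistent_excitation[where \<psi> = \<psi> and B = B and x = "x \<omega>" and v = "\<lambda>k. v k \<omega>" and N = N
          and c = "c / 2" and p = p] impulse_response_0[of p "\<lambda>i. \<theta> $ i" \<rho>] \<psi>.causal \<psi>.abs_le_bound
        cross white c_pos p unfolding \<psi>_def by auto
    have innov: "corr (x \<omega>) (\<lambda>k. v k \<omega>) (int i) (- 1) \<in> o(real)" for i
      using cross[of "int i" "- 1"] \<psi>.causal[of "- 1 - int i"] by simp
    have residual: "(\<lambda>n. corr (x \<omega>) (x \<omega>) (int i) (- 1) n
        - (\<Sum>j<p. corr (x \<omega>) (x \<omega>) (int i) (int j) n * theta_star p \<theta> \<rho> $ j)) \<in> o(real)" if "i < p" for i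
      by (rule normal_equation_residual_smallo[OF x_sq
            ar_process_innovation_form[OF p x_rec[OF elim(1)] e_rec[OF elim(1)]] innov c
            theta_star_equation[OF _ c] that])
    have "(\<lambda>n. ls_estimator p S (x \<omega>) n $ i) \<longlonglongrightarrow> theta_star p \<theta> \<rho> $ i" if "i < p" for i
      using ls_estimator_tendsto[where t = "\<lambda>j. theta_star p \<theta> \<rho> $ j", OF S \<kappa> residual that] .
    moreover have "ls_estimator p S (\<lambda>k. X k \<omega>) n = ls_estimator p S (x \<omega>) n" for n
    proof (rule ls_estimator_cong)
      fix k assume k: "- int p < k"
      show "X k \<omega> = x \<omega> k"
        using init_neg[of "nat (- k)" \<omega>] k elim(1) by (auto simp: x_def)
    qed (rule p)
    ultimately show ?case
      by simp
  qed
qed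

end
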